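(* There exists a randomized algorithm solving $(m-k)$-Hitting Set in expected time $O\big(8^{k+O(\sqrt{k})}(m+n)^{O(1)}\big)$.
   Context: A hypergraph $H$ consists of a nonempty finite vertex set $V(H)$ and a family $E(H)$ of nonempty subsets of $V(H)$ (edges), where parallel (repeated) edges are allowed. A set $S\subseteq V(H)$ is a hitting set if $e\cap S\neq\emptyset$ for every edge $e\in E(H)$. The problem $(m-k)$-Hitting Set: given a hypergraph $H$ with $n=|V(H)|$ and $m=|E(H)|$ (counted with multiplicity) and a positive integer $k$ (the parameter), decide whether $H$ has a hitting set of size at most $m-k$. *)

theory Defs
  imports "HOL-Probability.Probability" "HOL-Library.Log_Nat" "HOL-Library.Multiset"
begin

section \<open>Hypergraphs and hitting sets\<close>

locale hypergraph =
  fixes V :: "'a set" and E :: "'a set multiset"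
  assumes finite_vertices: "finite V"
    and vertices_nonempty: "V \<noteq> {}"
    and edge_subset: "e \<in># E \<Longrightarrow> e \<subseteq> V"
    and edge_nonempty: "e \<in># E \<Longrightarrow> e \<noteq> {}"

definition hitting_set :: "'a set \<Rightarrow> 'a set multiset \<Rightarrow> 'a set \<Rightarrow> bool" where
  "hitting_set V E S \<longleftrightarrow> S \<subseteq> V \<and> (\<forall>e\<in>#E. e \<inter> S \<noteq> {})"

text \<open>The bound \<open>m - k\<close> is an integer and may be negative; \<open>size\<close> counts parallel edges.\<close>

definition m_minus_k_hitting_set :: "'a set \<Rightarrow> 'a set multiset \<Rightarrow> nat \<Rightarrow> bool" where
  "m_minus_k_hitting_set V E k \<longleftrightarrow>
     (\<exists>S. hitting_set V E S \<and> int (card S) \<le> int (size E) - int k)"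


section \<open>Randomized random access machines with logarithmic cost\<close>

text \<open>
  Programs are while programs over a random access memory whose cells hold natural numbers of
  unbounded size. Loads and stores are indirect, and \<open>Flip\<close> stores a fair random bit.
  Subtraction is truncated and \<open>Div\<close> is integer division, with \<open>x div 0 = 0\<close>. A condition
  holds iff its value is nonzero.
\<close>

datatype expr =
    Const nat
  | Load expr
  | Add expr expr
  | Sub expr expr
  | Mult expr expr
  | Div expr expr

datatype prog =
    Skip
  | Store expr expr
  | Flip expr
  | Seq prog prog
  | If expr prog prog
  | While expr prog

type_synonym memory = "nat \<Rightarrow> nat"

fun val :: "memory \<Rightarrow> expr \<Rightarrow> nat" where
  "val M (Const c) = c"
| "val M (Load a) = M (val M a)"
| "val M (Add a b) = val M a + val M b"
| "val M (Sub a b) = val M a - val M b"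
| "val M (Mult a b) = val M a * val M b"
| "val M (Div a b) = val M a div val M b"

text \<open>
  \<open>floorlog 2 v\<close> is the length of the binary representation of \<open>v\<close> (and \<open>0\<close> for \<open>v = 0\<close>).
  Every operation is charged for its operands, including the addresses it uses, and its result,
  so no step can process long numbers for free.
\<close>

definition len :: "nat \<Rightarrow> nat" where
  "len v = Suc (floorlog 2 v)"

fun cost :: "memory \<Rightarrow> expr \<Rightarrow> nat" where
  "cost M (Const c) = len c"
| "cost M (Load a) = cost M a + len (val M (Load a))"
| "cost M (Add a b) = cost M a + cost M b + len (val M (Add a b))"
| "cost M (Sub a b) = cost M a + cost M b + len (val M (Sub a b))"
| "cost M (Mult a b) = cost M a + cost M b + len (val M (Mult a b))"
| "cost M (Div a b) = cost M a + cost M b + len (val M (Div a b))"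

text \<open>
  \<open>exec p M \<omega> t M' \<omega>'\<close>: started in memory \<open>M\<close> with the stream \<open>\<omega>\<close> of random bits, \<open>p\<close> halts
  after time \<open>t\<close> in memory \<open>M'\<close>, and \<open>\<omega>'\<close> is the unread rest of \<open>\<omega>\<close>.
\<close>

inductive exec :: "prog \<Rightarrow> memory \<Rightarrow> bool stream \<Rightarrow> nat \<Rightarrow> memory \<Rightarrow> bool stream \<Rightarrow> bool" where
  Skip: "exec Skip M \<omega> 1 M \<omega>"
| Store: "exec (Store a b) M \<omega> (cost M a + cost M b) (M(val M a := val M b)) \<omega>"
| Flip: "exec (Flip a) M \<omega> (cost M a + 1) (M(val M a := of_bool (shd \<omega>))) (stl \<omega>)"
| Seq: "exec p M \<omega> t M' \<omega>' \<Longrightarrow> exec q M' \<omega>' t' M'' \<omega>'' \<Longrightarrow> exec (Seq p q) M \<omega> (t + t') M'' \<omega>''"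
| IfTrue: "val M b \<noteq> 0 \<Longrightarrow> exec p M \<omega> t M' \<omega>' \<Longrightarrow> exec (If b p q) M \<omega> (cost M b + t) M' \<omega>'"
| IfFalse: "val M b = 0 \<Longrightarrow> exec q M \<omega> t M' \<omega>' \<Longrightarrow> exec (If b p q) M \<omega> (cost M b + t) M' \<omega>'"
| WhileFalse: "val M b = 0 \<Longrightarrow> exec (While b p) M \<omega> (cost M b) M \<omega>"
| WhileTrue: "val M b \<noteq> 0 \<Longrightarrow> exec p M \<omega> t M' \<omega>' \<Longrightarrow> exec (While b p) M' \<omega>' t' M'' \<omega>'' \<Longrightarrow>
    exec (While b p) M \<omega> (cost M b + t + t') M'' \<omega>''"

inductive_cases exec_elims:
  "exec Skip M \<omega> t M' \<omega>'"
  "exec (Store a b) M \<omega> t M' \<omega>'"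
  "exec (Flip a) M \<omega> t M' \<omega>'"
  "exec (Seq p q) M \<omega> t M' \<omega>'"
  "exec (If b p q) M \<omega> t M' \<omega>'"
inductive_cases exec_WhileE: "exec (While b p) M \<omega> t M' \<omega>'"

lemma exec_deterministic:
  "exec p M \<omega> t M1 \<omega>1 \<Longrightarrow> exec p M \<omega> u M2 \<omega>2 \<Longrightarrow> u = t \<and> M2 = M1 \<and> \<omega>2 = \<omega>1"
proof (induction arbitrary: u M2 \<omega>2 rule: exec.induct)
  case (Seq p M \<omega> t M' \<omega>' q t' M'' \<omega>'')
  from Seq.prems show ?case
  proof (rule exec_elims)
    fix a N \<rho> b
    assume "u = a + b" "exec p M \<omega> a N \<rho>" "exec q N \<rho> b M2 \<omega>2"
    with Seq.IH(1)[of a N \<rho>] Seq.IH(2)[of b M2 \<omega>2] show ?thesis by simp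
  qed
next
  case (WhileFalse M b p \<omega>)
  from WhileFalse.prems show ?case
    by (rule exec_WhileE) (use WhileFalse.hyps in auto)
next
  case (WhileTrue M b p \<omega> t M' \<omega>' t' M'' \<omega>'')
  from WhileTrue.prems show ?case
  proof (rule exec_WhileE)
    fix a N \<rho> c
    assume "u = cost M b + a + c" "exec p M \<omega> a N \<rho>" "exec (While b p) N \<rho> c M2 \<omega>2"
    with WhileTrue.IH(1)[of a N \<rho>] WhileTrue.IH(2)[of c M2 \<omega>2] show ?thesis by simp
  qed (use WhileTrue.hyps in simp)
next
  case (IfTrue M b p \<omega> t M' \<omega>' q)
  from IfTrue.prems show ?case
  proof (rule exec_elims)
    fix a assume "u = cost M b + a" "exec p M \<omega> a M2 \<omega>2"
    with IfTrue.IH[of a M2 \<omega>2] show ?thesis by simp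
  qed (use IfTrue.hyps in simp)
next
  case (IfFalse M b q \<omega> t M' \<omega>' p)
  from IfFalse.prems show ?case
  proof (rule exec_elims)
    fix a assume "u = cost M b + a" "exec q M \<omega> a M2 \<omega>2"
    with IfFalse.IH[of a M2 \<omega>2] show ?thesis by simp
  qed (use IfFalse.hyps in simp)
qed (erule exec_elims, simp)+

definition coins :: "bool stream measure" where
  "coins = stream_space (measure_pmf (bernoulli_pmf (1 / 2)))"

text \<open>The infimum ranges over at most one number and is \<open>\<infinity>\<close> if the program does not halt.\<close>

definition run_time :: "prog \<Rightarrow> memory \<Rightarrow> bool stream \<Rightarrow> ennreal" where
  "run_time p M \<omega> = (INF t\<in>{t. \<exists>M' \<omega>'. exec p M \<omega> t M' \<omega>'}. of_nat t)"

definition expected_time :: "prog \<Rightarrow> memory \<Rightarrow> ennreal" where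
  "expected_time p M = (\<integral>\<^sup>+ \<omega>. run_time p M \<omega> \<partial>coins)"

text \<open>The answer is read off cell \<open>0\<close> of the final memory.\<close>

definition answers :: "prog \<Rightarrow> memory \<Rightarrow> bool stream \<Rightarrow> bool \<Rightarrow> bool" where
  "answers p M \<omega> b \<longleftrightarrow> (\<exists>t M' \<omega>'. exec p M \<omega> t M' \<omega>' \<and> M' 0 = of_bool b)"


subsection \<open>Measurability of the running time\<close>

lemma run_time_eq: "exec p M \<omega> t M' \<omega>' \<Longrightarrow> run_time p M \<omega> = of_nat t"
proof -
  assume "exec p M \<omega> t M' \<omega>'"
  then have "{t. \<exists>M' \<omega>'. exec p M \<omega> t M' \<omega>'} = {t}"
    using exec_deterministic by blast
  then show ?thesis by (simp add: run_time_def)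
qed

lemma stake_addD:
  assumes "stake (n + m) \<eta> = stake (n + m) \<omega>"
  shows "stake n \<eta> = stake n \<omega>" "stake m (sdrop n \<eta>) = stake m (sdrop n \<omega>)"
proof -
  have "stake n \<eta> @ stake m (sdrop n \<eta>) = stake n \<omega> @ stake m (sdrop n \<omega>)"
    using assms by (simp only: stake_add)
  then show "stake n \<eta> = stake n \<omega>" "stake m (sdrop n \<eta>) = stake m (sdrop n \<omega>)"
    by (simp_all del: stake_add)
qed

lemma exec_prefix:
  "exec p M \<omega> t M' \<omega>' \<Longrightarrow>
   \<exists>n\<le>t. \<omega>' = sdrop n \<omega> \<and> (\<forall>\<eta>. stake n \<eta> = stake n \<omega> \<longrightarrow> exec p M \<eta> t M' (sdrop n \<eta>))"
proof (induction rule: exec.induct)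
  case (Skip M \<omega>)
  show ?case by (intro exI[of _ 0]) (use exec.Skip in simp)
next
  case (Store a b M \<omega>)
  show ?case by (intro exI[of _ 0]) (simp add: exec.Store del: fun_upd_apply)
next
  case (Flip a M \<omega>)
  have "exec (Flip a) M \<eta> (cost M a + 1) (M(val M a := of_bool (shd \<omega>))) (stl \<eta>)"
    if "shd \<eta> = shd \<omega>" for \<eta>
    using exec.Flip[of a M \<eta>] that by simp
  then show ?case by (intro exI[of _ 1]) (simp del: fun_upd_apply)
next
  case (Seq p M \<omega> t M' \<omega>' q t' M'' \<omega>'')
  from Seq.IH obtain n n' where n: "n \<le> t" "\<omega>' = sdrop n \<omega>"
      "\<And>\<eta>. stake n \<eta> = stake n \<omega> \<Longrightarrow> exec p M \<eta> t M' (sdrop n \<eta>)"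
    and n': "n' \<le> t'" "\<omega>'' = sdrop n' \<omega>'"
      "\<And>\<eta>. stake n' \<eta> = stake n' \<omega>' \<Longrightarrow> exec q M' \<eta> t' M'' (sdrop n' \<eta>)"
    by blast
  have "exec (Seq p q) M \<eta> (t + t') M'' (sdrop (n + n') \<eta>)"
    if "stake (n + n') \<eta> = stake (n + n') \<omega>" for \<eta>
  proof -
    have "stake n \<eta> = stake n \<omega>" "stake n' (sdrop n \<eta>) = stake n' \<omega>'"
      using stake_addD[OF that] n(2) by simp_all
    with n(3) n'(3) have "exec (Seq p q) M \<eta> (t + t') M'' (sdrop n' (sdrop n \<eta>))"
      by (blast intro: exec.Seq)
    then show ?thesis by (simp add: sdrop_add)
  qed
  moreover have "\<omega>'' = sdrop (n + n') \<omega>" using n(2) n'(2) by (simp add: sdrop_add)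
  moreover have "n + n' \<le> t + t'" using n(1) n'(1) by simp
  ultimately show ?case by blast
next
  case (IfTrue M b p \<omega> t M' \<omega>' q)
  then obtain n where "n \<le> t" "\<omega>' = sdrop n \<omega>"
    "\<forall>\<eta>. stake n \<eta> = stake n \<omega> \<longrightarrow> exec p M \<eta> t M' (sdrop n \<eta>)" by blast
  then show ?case using IfTrue.hyps by (intro exI[of _ n]) (auto intro: exec.IfTrue)
next
  case (IfFalse M b q \<omega> t M' \<omega>' p)
  then obtain n where "n \<le> t" "\<omega>' = sdrop n \<omega>"
    "\<forall>\<eta>. stake n \<eta> = stake n \<omega> \<longrightarrow> exec q M \<eta> t M' (sdrop n \<eta>)" by blast
  then show ?case using IfFalse.hyps by (intro exI[of _ n]) (auto intro: exec.IfFalse)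
next
  case (WhileFalse M b p \<omega>)
  then show ?case by (intro exI[of _ 0]) (auto intro: exec.WhileFalse)
next
  case (WhileTrue M b p \<omega> t M' \<omega>' t' M'' \<omega>'')
  from WhileTrue.IH obtain n n' where n: "n \<le> t" "\<omega>' = sdrop n \<omega>"
      "\<And>\<eta>. stake n \<eta> = stake n \<omega> \<Longrightarrow> exec p M \<eta> t M' (sdrop n \<eta>)"
    and n': "n' \<le> t'" "\<omega>'' = sdrop n' \<omega>'"
      "\<And>\<eta>. stake n' \<eta> = stake n' \<omega>' \<Longrightarrow> exec (While b p) M' \<eta> t' M'' (sdrop n' \<eta>)"
    by blast
  have "exec (While b p) M \<eta> (cost M b + t + t') M'' (sdrop (n + n') \<eta>)"
    if "stake (n + n') \<eta> = stake (n + n') \<omega>" for \<eta>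
  proof -
    have "stake n \<eta> = stake n \<omega>" "stake n' (sdrop n \<eta>) = stake n' \<omega>'"
      using stake_addD[OF that] n(2) by simp_all
    with n(3) n'(3) WhileTrue.hyps(1)
    have "exec (While b p) M \<eta> (cost M b + t + t') M'' (sdrop n' (sdrop n \<eta>))"
      by (blast intro: exec.WhileTrue)
    then show ?thesis by (simp add: sdrop_add)
  qed
  moreover have "\<omega>'' = sdrop (n + n') \<omega>" using n(2) n'(2) by (simp add: sdrop_add)
  moreover have "n + n' \<le> cost M b + t + t'" using n(1) n'(1) by simp
  ultimately show ?case by blast
qed

lemma exec_prefix_time:
  assumes "exec p M \<omega> t M' \<omega>'" "stake t \<eta> = stake t \<omega>"
  shows "\<exists>\<eta>'. exec p M \<eta> t M' \<eta>'"
proof -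
  obtain n where n: "n \<le> t" "\<forall>\<eta>. stake n \<eta> = stake n \<omega> \<longrightarrow> exec p M \<eta> t M' (sdrop n \<eta>)"
    using exec_prefix[OF assms(1)] by blast
  have "take n (stake t \<eta>) = take n (stake t \<omega>)" using assms(2) by simp
  then have "stake n \<eta> = stake n \<omega>" using n(1) by (simp add: take_stake min_def)
  with n(2) show ?thesis by blast
qed

lemma space_coins [simp]: "space coins = UNIV"
  by (simp add: coins_def space_stream_space)

lemma measurable_stake_coins: "stake t \<in> measurable coins (count_space UNIV)"
proof -
  have "sets coins = sets (stream_space (count_space UNIV))"
    unfolding coins_def by (rule sets_stream_space_cong) simp
  then show ?thesis by (simp cong: measurable_cong_sets)
qed

lemma sets_coins_prefix_closed:
  assumes "\<And>\<omega> \<eta>. P \<omega> \<Longrightarrow> stake t \<eta> = stake t \<omega> \<Longrightarrow> P \<eta>"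
  shows "{\<omega>. P \<omega>} \<in> sets coins"
proof -
  have "{\<omega>. P \<omega>} = stake t -` (stake t ` {\<omega>. P \<omega>}) \<inter> space coins"
    using assms by auto
  also have "\<dots> \<in> sets coins"
    by (rule measurable_sets[OF measurable_stake_coins]) simp
  finally show ?thesis .
qed

lemma run_time_measurable: "run_time p M \<in> borel_measurable coins"
proof -
  have halt: "{\<omega>. \<exists>M' \<omega>'. exec p M \<omega> t M' \<omega>'} \<in> sets coins" for t
    by (rule sets_coins_prefix_closed[of _ t]) (use exec_prefix_time in blast)
  have "(\<lambda>\<omega>. INF t. if \<omega> \<in> {\<omega>. \<exists>M' \<omega>'. exec p M \<omega> t M' \<omega>'} then of_nat t else top :: ennreal)
      \<in> borel_measurable coins"
    using halt by (intro borel_measurable_INF measurable_If_set) auto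
  also have "(\<lambda>\<omega>. INF t. if \<omega> \<in> {\<omega>. \<exists>M' \<omega>'. exec p M \<omega> t M' \<omega>'} then of_nat t else top :: ennreal)
      = run_time p M"
  proof (intro ext antisym)
    fix \<omega>
    let ?A = "{t. \<exists>M' \<omega>'. exec p M \<omega> t M' \<omega>'}"
    let ?f = "\<lambda>t. if \<omega> \<in> {\<omega>. \<exists>M' \<omega>'. exec p M \<omega> t M' \<omega>'} then of_nat t else top :: ennreal"
    show "(INF t. ?f t) \<le> run_time p M \<omega>"
      unfolding run_time_def
    proof (rule INF_greatest)
      fix t assume "t \<in> ?A"
      then have "?f t = of_nat t" by simp
      then show "(INF t. ?f t) \<le> of_nat t" using INF_lower[of t UNIV ?f] by simp
    qed
    show "run_time p M \<omega> \<le> (INF t. ?f t)"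
    proof (rule INF_greatest)
      fix t
      show "run_time p M \<omega> \<le> ?f t" by (auto simp: run_time_eq)
    qed
  qed
  finally show ?thesis .
qed

lemma answers_measurable: "{\<omega>. answers p M \<omega> b} \<in> sets coins"
proof -
  have "{\<omega>. \<exists>M' \<omega>'. exec p M \<omega> t M' \<omega>' \<and> M' 0 = of_bool b} \<in> sets coins" for t
    by (rule sets_coins_prefix_closed[of _ t]) (use exec_prefix_time in blast)
  then have "(\<Union>t. {\<omega>. \<exists>M' \<omega>'. exec p M \<omega> t M' \<omega>' \<and> M' 0 = of_bool b}) \<in> sets coins"
    by blast
  also have "(\<Union>t. {\<omega>. \<exists>M' \<omega>'. exec p M \<omega> t M' \<omega>' \<and> M' 0 = of_bool b}) = {\<omega>. answers p M \<omega> b}"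
    by (auto simp: answers_def)
  finally show ?thesis .
qed


section \<open>Presentation of the input\<close>

text \<open>
  A hypergraph is presented by listing its vertices and its edges (with multiplicity) in an
  arbitrary order. The machine receives \<open>n\<close>, \<open>m\<close> and \<open>k\<close> in the first three cells, followed by
  the \<open>m \<times> n\<close> incidence matrix, row by row; all other cells are \<open>0\<close>.
\<close>

definition presents :: "'a list \<Rightarrow> 'a set list \<Rightarrow> 'a set \<Rightarrow> 'a set multiset \<Rightarrow> bool" where
  "presents vs es V E \<longleftrightarrow> distinct vs \<and> set vs = V \<and> mset es = E"

definition input :: "'a list \<Rightarrow> 'a set list \<Rightarrow> nat \<Rightarrow> memory" where
  "input vs es k a =
    (let n = length vs; m = length es in
     if a = 0 then n
     else if a = 1 then m
     else if a = 2 then k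
     else let i = (a - 3) div n; j = (a - 3) mod n
          in of_bool (i < m \<and> vs ! j \<in> es ! i))"

end

theory Submission
  imports Defs
begin

text \<open>
  A deterministic algorithm with running time \<open>8 ^ k\<close> times a polynomial suffices. Greedily collect
  disjoint pairs of intersecting edges, stopping at \<open>k\<close> pairs. If \<open>k\<close> pairs are found, one vertex
  per pair and one per remaining edge form a hitting set of size \<open>m - k\<close>. Otherwise \<open>p < k\<close> pairs are
  found and the remaining \<open>m - 2 p\<close> edges are pairwise disjoint, so a hitting set contains a separate
  vertex for each of them, and a hitting set of size \<open>m - k\<close> has \<open>2 p - k\<close> vertices to spare. A dynamic
  program over the subsets of the \<open>2 p\<close> paired edges computes which of these subsets can be hit by
  such choices of vertices. Its table has rows of length \<open>4 ^ p \<le> 4 ^ k\<close>; handling numbers of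
  \<open>O(k + m + n)\<close> bits costs the factor that turns \<open>4 ^ k\<close> into at most \<open>8 ^ k\<close> times a polynomial.
\<close>

section \<open>Cost of expressions in bounded memories\<close>

text \<open>The program does not branch on the outcome of the pairing: the table is computed either
  way, and when \<open>k\<close> pairs exist the set of all marked edges is always reachable, so the
  table itself says yes. No sizes of hitting sets are stored. The budget of \<open>m - k\<close>
  vertices is built into the number of rows: each unmarked edge pays for one vertex, and all marked
  edges but \<open>k\<close> pay for one more. If \<open>2 * p < k\<close>, the disjoint unmarked
  edges alone exceed the budget, and a separate factor of the result turns the answer into no. As
  the machine has no bit operations, the union of two sets is formed by division, parity and
  addition. To keep the analysis of logarithmic cost apart from correctness, one bound on the length
  of all cell contents gives one bound \<open>unit_cost\<close> for every expression of the program;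
  after that only loop lengths are multiplied.\<close>

fun esize :: "expr \<Rightarrow> nat" where
  "esize (Const c) = 1"
| "esize (Load a) = Suc (esize a)"
| "esize (Add a b) = Suc (esize a + esize b)"
| "esize (Sub a b) = Suc (esize a + esize b)"
| "esize (Mult a b) = Suc (esize a + esize b)"
| "esize (Div a b) = Suc (esize a + esize b)"

fun consts_le :: "nat \<Rightarrow> expr \<Rightarrow> bool" where
  "consts_le B (Const c) \<longleftrightarrow> c \<le> B"
| "consts_le B (Load a) \<longleftrightarrow> consts_le B a"
| "consts_le B (Add a b) \<longleftrightarrow> consts_le B a \<and> consts_le B b"
| "consts_le B (Sub a b) \<longleftrightarrow> consts_le B a \<and> consts_le B b"
| "consts_le B (Mult a b) \<longleftrightarrow> consts_le B a \<and> consts_le B b"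
| "consts_le B (Div a b) \<longleftrightarrow> consts_le B a \<and> consts_le B b"

lemma consts_le_mono: "consts_le A e \<Longrightarrow> A \<le> B \<Longrightarrow> consts_le B e"
  by (induction e) auto

text \<open>A product adds the exponents of its factors. A sum needs one further bit, which the
  \<open>Suc\<close> in \<open>esize\<close> pays for because \<open>L > 0\<close>. A load starts
  again at \<open>L\<close>, however large its address is.\<close>

lemma val_le:
  assumes "\<And>a. M a \<le> 2 ^ L" "consts_le (2 ^ L) e" "L > 0"
  shows "val M e \<le> 2 ^ (L * esize e)"
  using assms(2)
proof (induction e)
  case (Const c)
  then show ?case by simp
next
  case (Load a)
  have "val M (Load a) \<le> 2 ^ L" using assms(1) by simp
  also have "\<dots> \<le> 2 ^ (L * esize (Load a))" by (rule power_increasing) auto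
  finally show ?case .
next
  case (Add a b)
  have "val M (Add a b) \<le> 2 ^ (L * esize a) + 2 ^ (L * esize b)"
    using Add by (simp add: add_mono)
  also have "\<dots> \<le> 2 ^ (L * esize a + L * esize b) + 2 ^ (L * esize a + L * esize b)"
    by (intro add_mono power_increasing) auto
  also have "\<dots> = 2 ^ Suc (L * esize a + L * esize b)" by simp
  also have "\<dots> \<le> 2 ^ (L * esize (Add a b))"
    by (rule power_increasing) (use assms(3) in \<open>auto simp: algebra_simps\<close>)
  finally show ?case .
next
  case (Sub a b)
  have "val M (Sub a b) \<le> 2 ^ (L * esize a)" using Sub by (simp add: le_diff_conv trans_le_add1)
  also have "\<dots> \<le> 2 ^ (L * esize (Sub a b))"
    by (rule power_increasing) (auto simp: algebra_simps)
  finally show ?case .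
next
  case (Mult a b)
  have "val M (Mult a b) \<le> 2 ^ (L * esize a) * 2 ^ (L * esize b)"
    using Mult by (simp add: mult_mono)
  also have "\<dots> = 2 ^ (L * esize a + L * esize b)" by (simp add: power_add)
  also have "\<dots> \<le> 2 ^ (L * esize (Mult a b))"
    by (rule power_increasing) (auto simp: algebra_simps)
  finally show ?case .
next
  case (Div a b)
  have "val M (Div a b) \<le> 2 ^ (L * esize a)"
    using Div by simp (meson div_le_dividend le_trans)
  also have "\<dots> \<le> 2 ^ (L * esize (Div a b))"
    by (rule power_increasing) (auto simp: algebra_simps)
  finally show ?case .
qed

lemma len_le: "v \<le> 2 ^ l \<Longrightarrow> len v \<le> l + 2"
proof -
  assume "v \<le> 2 ^ l"
  then have "floorlog 2 v \<le> floorlog 2 (2 ^ l)" by (rule floorlog_mono)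
  also have "\<dots> = l + 1" by (simp add: floorlog_def)
  finally show ?thesis by (simp add: len_def)
qed

text \<open>Each of the \<open>esize e\<close> nodes is charged the length of one value, and
  \<open>val_le\<close> bounds all these values. The summand \<open>2\<close> comes from
  \<open>len_le\<close>: one for the length of an exact power of two, one for the \<open>Suc\<close>
  in \<open>len\<close>.\<close>

lemma cost_le:
  assumes M: "\<And>a. M a \<le> 2 ^ L" and L: "L > 0" and "consts_le (2 ^ L) e"
  shows "cost M e \<le> esize e * (L * esize e + 2)"
  using assms(3)
proof (induction e)
  case (Const c)
  then show ?case using len_le[of c L] by simp
next
  case (Load a)
  have "len (val M (Load a)) \<le> L + 2" by (rule len_le) (use M in simp)
  with Load show ?case by (simp add: algebra_simps)
next
  case (Add a b)
  have "len (val M (Add a b)) \<le> L * esize (Add a b) + 2"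
    by (rule len_le) (rule val_le[OF M Add.prems L])
  with Add show ?case by (simp add: algebra_simps)
next
  case (Sub a b)
  have "len (val M (Sub a b)) \<le> L * esize (Sub a b) + 2"
    by (rule len_le) (rule val_le[OF M Sub.prems L])
  with Sub show ?case by (simp add: algebra_simps)
next
  case (Mult a b)
  have "len (val M (Mult a b)) \<le> L * esize (Mult a b) + 2"
    by (rule len_le) (rule val_le[OF M Mult.prems L])
  with Mult show ?case by (simp add: algebra_simps)
next
  case (Div a b)
  have "len (val M (Div a b)) \<le> L * esize (Div a b) + 2"
    by (rule len_le) (rule val_le[OF M Div.prems L])
  with Div show ?case by (simp add: algebra_simps)
qed

section \<open>The program\<close>

text \<open>
  The input fills the cells below \<open>3 + m n\<close>. Behind it lie nine registers, the array of the
  weights of the \<open>m\<close> edges, and the table of the dynamic program.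
\<close>

definition base :: expr where
  "base = Add (Const 3) (Mult (Load (Const 1)) (Load (Const 0)))"

definition reg_at :: "nat \<Rightarrow> expr" where
  "reg_at c = Add base (Const c)"

definition weight_at :: "expr \<Rightarrow> expr" where
  "weight_at e = Add base (Add (Const 9) e)"

definition table_at :: "expr \<Rightarrow> expr" where
  "table_at e = Add base (Add (Const 9) (Add (Load (Const 1)) e))"

definition reg :: "nat \<Rightarrow> expr" where
  "reg c = Load (reg_at c)"

definition weight :: "expr \<Rightarrow> expr" where
  "weight e = Load (weight_at e)"

definition table :: "expr \<Rightarrow> expr" where
  "table e = Load (table_at e)"

definition incident :: "nat \<Rightarrow> nat \<Rightarrow> expr" where
  "incident c d = Load (Add (Const 3) (Add (Mult (reg c) (Load (Const 0))) (reg d)))"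

definition num_n :: expr where "num_n = Load (Const 0)"
definition num_m :: expr where "num_m = Load (Const 1)"
definition num_k :: expr where "num_k = Load (Const 2)"

lemmas expr_defs = base_def reg_at_def weight_at_def table_at_def reg_def weight_def table_def
  incident_def num_n_def num_m_def num_k_def

text \<open>Truncated subtraction serves as the comparison of counter and bound. The bound is
  evaluated anew at each test, so it may be a register, provided that the body preserves it.\<close>

definition For :: "nat \<Rightarrow> expr \<Rightarrow> prog \<Rightarrow> prog" where
  "For c e body = Seq (Store (reg_at c) (Const 0))
     (While (Sub e (reg c)) (Seq body (Store (reg_at c) (Add (reg c) (Const 1)))))"

text \<open>
  The registers hold the next free weight, the number of pairs, the loop counters, the set under
  construction, the offset of the current table row, and the number of skipped marked edges.
\<close>

abbreviation (input) "rW \<equiv> 0 :: nat"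
abbreviation (input) "rP \<equiv> 1 :: nat"
abbreviation (input) "rI \<equiv> 2 :: nat"
abbreviation (input) "rJ \<equiv> 3 :: nat"
abbreviation (input) "rV \<equiv> 4 :: nat"
abbreviation (input) "rX \<equiv> 5 :: nat"
abbreviation (input) "rY \<equiv> 6 :: nat"
abbreviation (input) "rR \<equiv> 7 :: nat"
abbreviation (input) "rC \<equiv> 8 :: nat"

text \<open>Conditions are arithmetic: products are conjunctions, sums disjunctions, truncated
  differences comparisons. The last factor is nonzero only if both edges are unmarked; the
  difference of \<open>k\<close> and the number of pairs stops the pairing at \<open>k\<close>
  pairs.\<close>

definition pair_cond :: expr where
  "pair_cond = Mult (Mult (incident rI rV) (incident rJ rV))
     (Mult (Sub num_k (reg rP)) (Sub (Const 1) (Add (weight (reg rI)) (weight (reg rJ)))))"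

definition pair_step :: prog where
  "pair_step = If pair_cond
     (Seq (Store (weight_at (reg rI)) (reg rW))
     (Seq (Store (weight_at (reg rJ)) (Mult (Const 2) (reg rW)))
     (Seq (Store (reg_at rW) (Mult (Const 4) (reg rW)))
          (Store (reg_at rP) (Add (reg rP) (Const 1))))))
     Skip"

definition pair_phase :: prog where
  "pair_phase = Seq (Store (reg_at rW) (Const 1))
     (For rI num_m (For rJ (reg rI) (For rV num_n pair_step)))"

definition quot :: expr where "quot = Div (reg rY) (weight (reg rJ))"

text \<open>\<open>quot\<close> minus twice its half is its parity, that is, the bit of the edge in
  the code held by \<open>rY\<close>. The condition thus asks for a marked edge through the vertex
  that is not yet in the set.\<close>

definition join_cond :: expr where
  "join_cond = Mult (Mult (weight (reg rJ)) (incident rJ rV))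
     (Sub (Const 1) (Sub quot (Mult (Const 2) (Div quot (Const 2)))))"

definition join_step :: prog where
  "join_step = If join_cond (Store (reg_at rY) (Add (reg rY) (weight (reg rJ)))) Skip"

definition move_cond :: expr where
  "move_cond = Mult (table (Add (reg rR) (reg rX))) (Add (incident rI rV) (weight (reg rI)))"

definition move_step :: prog where
  "move_step = If move_cond
     (Seq (Store (reg_at rY) (reg rX))
     (Seq (For rJ num_m join_step)
          (Store (table_at (Add (reg rR) (Add (reg rW) (reg rY)))) (Const 1))))
     Skip"

definition row_cond :: expr where
  "row_cond = Add (Sub (Const 1) (weight (reg rI))) (Sub (Const 1) (Sub num_k (reg rC)))"

text \<open>A new row is written directly behind the current one, into cells that still hold
  \<open>0\<close>, so nothing has to be cleared and the row being read is never overwritten. A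
  skipped edge produces no row.\<close>

definition row_step :: prog where
  "row_step = If row_cond
     (Seq (For rX (reg rW) (For rV num_n move_step))
          (Store (reg_at rR) (Add (reg rR) (reg rW))))
     (Store (reg_at rC) (Add (reg rC) (Const 1)))"

definition table_phase :: prog where
  "table_phase = Seq (Store (table_at (Const 0)) (Const 1)) (For rI num_m row_step)"

text \<open>\<open>rW\<close> ends as \<open>4 ^ p\<close>, so \<open>rW - 1\<close> is the sum of
  all weights, the code of the set of all marked edges. The first factor vanishes if fewer than
  \<open>k\<close> edges were skipped; then there are more than \<open>m - k\<close> rows.\<close>

definition result :: expr where
  "result = Mult (Sub (Const 1) (Sub num_k (reg rC)))
     (table (Add (reg rR) (Sub (reg rW) (Const 1))))"

definition hitting_set_prog :: prog where
  "hitting_set_prog = Seq pair_phase (Seq table_phase (Store (Const 0) result))"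

text \<open>The numbers are uniform upper bounds for the expressions of this fixed program. The
  bound \<open>16 = 2 ^ 4\<close> on constants matches the summand \<open>4\<close> in
  \<open>bits\<close>.\<close>

definition small :: "expr \<Rightarrow> bool" where
  "small e \<longleftrightarrow> esize e \<le> 300 \<and> consts_le 16 e"

lemmas small_defs = small_def expr_defs pair_cond_def quot_def join_cond_def move_cond_def
  row_cond_def result_def

section \<open>Execution on a structured memory\<close>

locale incidence =
  fixes n m k :: nat and inc :: "nat \<Rightarrow> nat \<Rightarrow> bool"
  assumes n_pos: "0 < n"
begin

text \<open>The table takes the whole unbounded rest of the memory, so three zero functions yield
  exactly the input. Values of \<open>v\<close> from \<open>9\<close> on and of \<open>\<mu>\<close>
  from \<open>m\<close> on are not stored.\<close>

definition mem :: "(nat \<Rightarrow> nat) \<Rightarrow> (nat \<Rightarrow> nat) \<Rightarrow> (nat \<Rightarrow> nat) \<Rightarrow> memory" where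
  "mem v \<mu> T a =
    (if a = 0 then n else if a = 1 then m else if a = 2 then k
     else if a < 3 + m * n then of_bool (inc ((a - 3) div n) ((a - 3) mod n))
     else if a < 12 + m * n then v (a - (3 + m * n))
     else if a < 12 + m * n + m then \<mu> (a - (12 + m * n))
     else T (a - (12 + m * n + m)))"

text \<open>\<open>2 * k\<close> bits hold the code of a set of at most \<open>2 * k\<close> marked
  edges; the remaining bits hold a factor of at most \<open>m + n + 4\<close>, as needed for table
  offsets. Absolute addresses may be longer, but they are never stored and are covered by
  \<open>val_le\<close>.\<close>

definition bits :: nat where "bits = 2 * k + m + n + 4"

definition unit_cost :: nat where "unit_cost = 300 * (bits * 300 + 2)"

definition bounded :: "(nat \<Rightarrow> nat) \<Rightarrow> (nat \<Rightarrow> nat) \<Rightarrow> (nat \<Rightarrow> nat) \<Rightarrow> bool" where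
  "bounded v \<mu> T \<longleftrightarrow> (\<forall>a. v a \<le> 2 ^ bits) \<and> (\<forall>a. \<mu> a \<le> 2 ^ bits) \<and> (\<forall>a. T a \<le> 2 ^ bits)"

lemma le_bits: "a \<le> (b + 1) * 4 ^ k \<Longrightarrow> b \<le> m + n + 3 \<Longrightarrow> a \<le> 2 ^ bits"
proof -
  assume "a \<le> (b + 1) * 4 ^ k" "b \<le> m + n + 3"
  have "b + 1 \<le> 2 ^ (m + n + 4)"
    using \<open>b \<le> m + n + 3\<close> less_exp[of "m + n + 4"] by linarith
  then have "(b + 1) * 4 ^ k \<le> 2 ^ (m + n + 4) * 4 ^ k" by (rule mult_le_mono1)
  also have "\<dots> = 2 ^ bits" unfolding bits_def by (simp add: power_add power_mult)
  finally show ?thesis using \<open>a \<le> (b + 1) * 4 ^ k\<close> by linarith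
qed

lemma small_le_bits: "a \<le> m + n + 3 \<Longrightarrow> a \<le> 2 ^ bits"
  using le_bits[of a a] by (simp add: Suc_leI trans_le_add2)

lemma k_le_bits: "k \<le> 2 ^ bits"
proof -
  have "k < 2 ^ k" by (rule less_exp)
  also have "(2::nat) ^ k \<le> 2 ^ bits" by (rule power_increasing) (auto simp: bits_def)
  finally show ?thesis by simp
qed

lemma mem_bounded: "bounded v \<mu> T \<Longrightarrow> mem v \<mu> T a \<le> 2 ^ bits"
  by (auto simp: mem_def bounded_def k_le_bits intro: small_le_bits)

lemma bounded_reg: "bounded v \<mu> T \<Longrightarrow> x \<le> 2 ^ bits \<Longrightarrow> bounded (v(c := x)) \<mu> T"
  and bounded_weight: "bounded v \<mu> T \<Longrightarrow> x \<le> 2 ^ bits \<Longrightarrow> bounded v (\<mu>(c := x)) T"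
  and bounded_table: "bounded v \<mu> T \<Longrightarrow> x \<le> 2 ^ bits \<Longrightarrow> bounded v \<mu> (T(c := x))"
  by (auto simp: bounded_def)

lemma cost_small: "bounded v \<mu> T \<Longrightarrow> small e \<Longrightarrow> cost (mem v \<mu> T) e \<le> unit_cost"
proof -
  assume b: "bounded v \<mu> T" and s: "small e"
  have "(16::nat) = 2 ^ 4" by simp
  also have "\<dots> \<le> 2 ^ bits" by (rule power_increasing) (auto simp: bits_def)
  finally have "consts_le (2 ^ bits) e" using s consts_le_mono by (auto simp: small_def)
  then have "cost (mem v \<mu> T) e \<le> esize e * (bits * esize e + 2)"
    by (intro cost_le mem_bounded b) (auto simp: bits_def)
  also have "\<dots> \<le> unit_cost"
    unfolding unit_cost_def by (intro mult_mono add_mono) (use s in \<open>auto simp: small_def\<close>)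
  finally show ?thesis .
qed

lemma val_reg_at [simp]: "val (mem v \<mu> T) (reg_at c) = 3 + m * n + c"
  and val_weight_at [simp]: "val (mem v \<mu> T) (weight_at e) = 12 + m * n + val (mem v \<mu> T) e"
  and val_table_at [simp]: "val (mem v \<mu> T) (table_at e) = 12 + m * n + m + val (mem v \<mu> T) e"
  and val_num [simp]: "val (mem v \<mu> T) num_n = n" "val (mem v \<mu> T) num_m = m"
    "val (mem v \<mu> T) num_k = k"
  by (auto simp: expr_defs mem_def)

lemma val_reg [simp]: "c < 9 \<Longrightarrow> val (mem v \<mu> T) (reg c) = v c"
  unfolding reg_def by (simp, simp add: mem_def)

lemma val_weight [simp]: "val (mem v \<mu> T) e < m \<Longrightarrow> val (mem v \<mu> T) (weight e) = \<mu> (val (mem v \<mu> T) e)"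
  unfolding weight_def by (simp, simp add: mem_def)

lemma val_table [simp]: "val (mem v \<mu> T) (table e) = T (val (mem v \<mu> T) e)"
  unfolding table_def by (simp, simp add: mem_def)

lemma val_incident [simp]:
  assumes "c < 9" "d < 9" "v c < m" "v d < n"
  shows "val (mem v \<mu> T) (incident c d) = of_bool (inc (v c) (v d))"
proof -
  have "v c * n + v d < v c * n + n" using assms by simp
  also have "\<dots> = Suc (v c) * n" by simp
  also have "\<dots> \<le> m * n" by (rule mult_le_mono1) (use assms in simp)
  finally have "v c * n + v d < m * n" .
  then have "mem v \<mu> T (3 + (v c * n + v d)) = of_bool (inc (v c) (v d))"
    unfolding mem_def using assms by auto
  moreover have "mem v \<mu> T 0 = n" by (simp add: mem_def)
  ultimately show ?thesis unfolding incident_def using assms by simp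
qed

lemma mem_reg_update: "c < 9 \<Longrightarrow> (mem v \<mu> T)(3 + m * n + c := x) = mem (v(c := x)) \<mu> T"
  by (rule ext) (auto simp: mem_def)

lemma mem_weight_update: "i < m \<Longrightarrow> (mem v \<mu> T)(12 + m * n + i := x) = mem v (\<mu>(i := x)) T"
  by (rule ext) (auto simp: mem_def)

lemma mem_table_update: "(mem v \<mu> T)(12 + m * n + m + a := x) = mem v \<mu> (T(a := x))"
  by (rule ext) (auto simp: mem_def)

text \<open>Total correctness with a time bound. The coin stream is returned unread, and the final
  memory must again have the structured form, so that triples can be chained.\<close>

definition wp where
  "wp p t Q v \<mu> T \<longleftrightarrow> (\<forall>\<omega>. \<exists>u v' \<mu>' T'.
     exec p (mem v \<mu> T) \<omega> u (mem v' \<mu>' T') \<omega> \<and> u \<le> t \<and> Q v' \<mu>' T')"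

lemma wp_mono:
  "wp p t Q v \<mu> T \<Longrightarrow> t \<le> t' \<Longrightarrow> (\<And>v \<mu> T. Q v \<mu> T \<Longrightarrow> Q' v \<mu> T) \<Longrightarrow> wp p t' Q' v \<mu> T"
  unfolding wp_def by (meson le_trans)

section \<open>Rules for the single statements\<close>

lemma unit_pos: "1 \<le> unit_cost" by (simp add: unit_cost_def)

lemma wp_Skip: "Q v \<mu> T \<Longrightarrow> wp Skip unit_cost Q v \<mu> T"
  unfolding wp_def using exec.Skip unit_pos by blast

lemma small_reg_at: "c < 9 \<Longrightarrow> small (reg_at c)"
  by (simp add: small_defs)

lemma wp_Store_reg:
  assumes "c < 9" "small e" "bounded v \<mu> T" "Q (v(c := val (mem v \<mu> T) e)) \<mu> T"
  shows "wp (Store (reg_at c) e) (2 * unit_cost) Q v \<mu> T"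
  unfolding wp_def
proof
  fix \<omega>
  have "exec (Store (reg_at c) e) (mem v \<mu> T) \<omega> (cost (mem v \<mu> T) (reg_at c) + cost (mem v \<mu> T) e)
    (mem (v(c := val (mem v \<mu> T) e)) \<mu> T) \<omega>"
    using exec.Store[of "reg_at c" e "mem v \<mu> T" \<omega>] assms(1) mem_reg_update by simp
  moreover have "cost (mem v \<mu> T) (reg_at c) + cost (mem v \<mu> T) e \<le> 2 * unit_cost"
    using cost_small[OF assms(3) assms(2)] cost_small[OF assms(3) small_reg_at[OF assms(1)]] by linarith
  ultimately show "\<exists>u v' \<mu>' T'. exec (Store (reg_at c) e) (mem v \<mu> T) \<omega> u (mem v' \<mu>' T') \<omega>
      \<and> u \<le> 2 * unit_cost \<and> Q v' \<mu>' T'"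
    using assms(4) by blast
qed

lemma wp_Store_weight:
  assumes "val (mem v \<mu> T) a < m" "small (weight_at a)" "small e" "bounded v \<mu> T"
    "Q v (\<mu>(val (mem v \<mu> T) a := val (mem v \<mu> T) e)) T"
  shows "wp (Store (weight_at a) e) (2 * unit_cost) Q v \<mu> T"
  unfolding wp_def
proof
  fix \<omega>
  have "exec (Store (weight_at a) e) (mem v \<mu> T) \<omega> (cost (mem v \<mu> T) (weight_at a) + cost (mem v \<mu> T) e)
    (mem v (\<mu>(val (mem v \<mu> T) a := val (mem v \<mu> T) e)) T) \<omega>"
    using exec.Store[of "weight_at a" e "mem v \<mu> T" \<omega>] assms(1) mem_weight_update by simp
  moreover have "cost (mem v \<mu> T) (weight_at a) + cost (mem v \<mu> T) e \<le> 2 * unit_cost"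
    using cost_small[OF assms(4) assms(2)] cost_small[OF assms(4) assms(3)] by linarith
  ultimately show "\<exists>u v' \<mu>' T'. exec (Store (weight_at a) e) (mem v \<mu> T) \<omega> u (mem v' \<mu>' T') \<omega>
      \<and> u \<le> 2 * unit_cost \<and> Q v' \<mu>' T'"
    using assms(5) by blast
qed

lemma wp_Store_table:
  assumes "small (table_at a)" "small e" "bounded v \<mu> T"
    "Q v \<mu> (T(val (mem v \<mu> T) a := val (mem v \<mu> T) e))"
  shows "wp (Store (table_at a) e) (2 * unit_cost) Q v \<mu> T"
  unfolding wp_def
proof
  fix \<omega>
  have "exec (Store (table_at a) e) (mem v \<mu> T) \<omega> (cost (mem v \<mu> T) (table_at a) + cost (mem v \<mu> T) e)
    (mem v \<mu> (T(val (mem v \<mu> T) a := val (mem v \<mu> T) e))) \<omega>"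
    using exec.Store[of "table_at a" e "mem v \<mu> T" \<omega>] mem_table_update by simp
  moreover have "cost (mem v \<mu> T) (table_at a) + cost (mem v \<mu> T) e \<le> 2 * unit_cost"
    using cost_small[OF assms(3) assms(1)] cost_small[OF assms(3) assms(2)] by linarith
  ultimately show "\<exists>u v' \<mu>' T'. exec (Store (table_at a) e) (mem v \<mu> T) \<omega> u (mem v' \<mu>' T') \<omega>
      \<and> u \<le> 2 * unit_cost \<and> Q v' \<mu>' T'"
    using assms(4) by blast
qed

lemma wp_Seq:
  assumes "wp p t Q v \<mu> T" "\<And>v \<mu> T. Q v \<mu> T \<Longrightarrow> wp q t' R v \<mu> T"
  shows "wp (Seq p q) (t + t') R v \<mu> T"
  unfolding wp_def
proof
  fix \<omega>
  obtain u v' \<mu>' T' where 1: "exec p (mem v \<mu> T) \<omega> u (mem v' \<mu>' T') \<omega>" "u \<le> t" "Q v' \<mu>' T'"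
    using assms(1) unfolding wp_def by blast
  obtain u' v'' \<mu>'' T'' where 2: "exec q (mem v' \<mu>' T') \<omega> u' (mem v'' \<mu>'' T'') \<omega>" "u' \<le> t'" "R v'' \<mu>'' T''"
    using assms(2)[OF 1(3)] unfolding wp_def by blast
  show "\<exists>u v' \<mu>' T'. exec (Seq p q) (mem v \<mu> T) \<omega> u (mem v' \<mu>' T') \<omega> \<and> u \<le> t + t' \<and> R v' \<mu>' T'"
    using exec.Seq[OF 1(1) 2(1)] 1(2) 2(2,3) by (meson add_mono)
qed

text \<open>The assertion between the two statements is taken to be the \<open>wp\<close> of the
  second, so straight-line code needs no intermediate assertions.\<close>

lemma wp_Seq_backward:
  "wp p t (wp q t' R) v \<mu> T \<Longrightarrow> wp (Seq p q) (t + t') R v \<mu> T"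
  by (rule wp_Seq)

lemma wp_If:
  assumes "small b" "bounded v \<mu> T"
    "val (mem v \<mu> T) b \<noteq> 0 \<Longrightarrow> wp p t Q v \<mu> T" "val (mem v \<mu> T) b = 0 \<Longrightarrow> wp q t Q v \<mu> T"
  shows "wp (If b p q) (unit_cost + t) Q v \<mu> T"
  unfolding wp_def
proof
  fix \<omega>
  have c: "cost (mem v \<mu> T) b \<le> unit_cost" by (rule cost_small[OF assms(2,1)])
  show "\<exists>u v' \<mu>' T'. exec (If b p q) (mem v \<mu> T) \<omega> u (mem v' \<mu>' T') \<omega> \<and> u \<le> unit_cost + t \<and> Q v' \<mu>' T'"
  proof (cases "val (mem v \<mu> T) b = 0")
    case True
    from assms(4)[OF this] obtain u v' \<mu>' T'
      where "exec q (mem v \<mu> T) \<omega> u (mem v' \<mu>' T') \<omega>" "u \<le> t" "Q v' \<mu>' T'"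
      unfolding wp_def by blast
    with True c show ?thesis by (meson exec.IfFalse add_mono)
  next
    case False
    from assms(3)[OF this] obtain u v' \<mu>' T'
      where "exec p (mem v \<mu> T) \<omega> u (mem v' \<mu>' T') \<omega>" "u \<le> t" "Q v' \<mu>' T'"
      unfolding wp_def by blast
    with False c show ?thesis by (meson exec.IfTrue add_mono)
  qed
qed

text \<open>Setting the counter costs two units and the failing last test one; every iteration pays
  for the body, one test and an increment of two units.\<close>

definition loop_time :: "nat \<Rightarrow> nat \<Rightarrow> nat" where
  "loop_time N t = 3 * unit_cost + N * (t + 3 * unit_cost)"

text \<open>\<open>I i\<close> describes the state at the test with counter value \<open>i\<close>.
  As the invariant fixes the value \<open>N\<close> of the bound and the body leaves the counter
  alone, there are exactly \<open>N\<close> iterations.\<close>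

lemma wp_For:
  assumes c: "c < 9" "small (Sub e (reg c))"
    and init: "bounded v \<mu> T" "I 0 (v(c := 0)) \<mu> T"
    and inv: "\<And>i v \<mu> T. I i v \<mu> T \<Longrightarrow> bounded v \<mu> T \<and> v c = i \<and> val (mem v \<mu> T) e = N"
    and step: "\<And>i v \<mu> T. i < N \<Longrightarrow> I i v \<mu> T \<Longrightarrow>
      wp body t (\<lambda>v \<mu> T. bounded v \<mu> T \<and> v c = i \<and> I (Suc i) (v(c := Suc i)) \<mu> T) v \<mu> T"
  shows "wp (For c e body) (loop_time N t) (I N) v \<mu> T"
proof -
  let ?b = "Sub e (reg c)"
  let ?p = "Seq body (Store (reg_at c) (Add (reg c) (Const 1)))"
  have body: "wp ?p (t + 2 * unit_cost) (I (Suc i)) v \<mu> T" if "i < N" "I i v \<mu> T" for i v \<mu> T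
  proof (rule wp_Seq[OF step[OF that]])
    fix v \<mu> T
    assume *: "bounded v \<mu> T \<and> v c = i \<and> I (Suc i) (v(c := Suc i)) \<mu> T"
    show "wp (Store (reg_at c) (Add (reg c) (Const 1))) (2 * unit_cost) (I (Suc i)) v \<mu> T"
    proof (rule wp_Store_reg)
      show "small (Add (reg c) (Const 1))" using c by (simp add: small_defs)
    qed (use * c in auto)
  qed
  have loop: "wp (While ?b ?p) (unit_cost + d * (t + 3 * unit_cost)) (I N) v \<mu> T"
    if "I i v \<mu> T" "i + d = N" for d i v \<mu> T
    using that
  proof (induction d arbitrary: i v \<mu> T)
    case 0
    note iv = inv[OF 0(1)]
    have "val (mem v \<mu> T) ?b = 0" using iv c 0(2) by simp
    then have e: "exec (While ?b ?p) (mem v \<mu> T) \<omega> (cost (mem v \<mu> T) ?b) (mem v \<mu> T) \<omega>" for \<omega>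
      by (rule exec.WhileFalse)
    have "cost (mem v \<mu> T) ?b \<le> unit_cost" using iv c by (intro cost_small) auto
    moreover have "I N v \<mu> T" using 0 by simp
    ultimately have "wp (While ?b ?p) unit_cost (I N) v \<mu> T"
      unfolding wp_def using e by blast
    then show ?case by simp
  next
    case (Suc d)
    note iv = inv[OF Suc.prems(1)]
    have iN: "i < N" using Suc.prems(2) by simp
    have nz: "val (mem v \<mu> T) ?b \<noteq> 0" using iv c Suc.prems(2) by simp
    have cb: "cost (mem v \<mu> T) ?b \<le> unit_cost" using iv c by (intro cost_small) auto
    show ?case unfolding wp_def
    proof
      fix \<omega>
      obtain u v' \<mu>' T' where 1: "exec ?p (mem v \<mu> T) \<omega> u (mem v' \<mu>' T') \<omega>"
          "u \<le> t + 2 * unit_cost" "I (Suc i) v' \<mu>' T'"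
        using body[OF iN Suc.prems(1)] unfolding wp_def by blast
      obtain u' v'' \<mu>'' T'' where 2: "exec (While ?b ?p) (mem v' \<mu>' T') \<omega> u' (mem v'' \<mu>'' T'') \<omega>"
          "u' \<le> unit_cost + d * (t + 3 * unit_cost)" "I N v'' \<mu>'' T''"
        using Suc.IH[OF 1(3)] Suc.prems(2) unfolding wp_def by (metis add_Suc_shift)
      have "cost (mem v \<mu> T) ?b + u + u' \<le> unit_cost + Suc d * (t + 3 * unit_cost)"
        using cb 1(2) 2(2) by simp
      with exec.WhileTrue[OF nz 1(1) 2(1)] 2(3)
      show "\<exists>u v' \<mu>' T'. exec (While ?b ?p) (mem v \<mu> T) \<omega> u (mem v' \<mu>' T') \<omega> \<and>
          u \<le> unit_cost + Suc d * (t + 3 * unit_cost) \<and> I N v' \<mu>' T'"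
        by blast
    qed
  qed
  have "wp (For c e body) (2 * unit_cost + (unit_cost + N * (t + 3 * unit_cost))) (I N) v \<mu> T"
    unfolding For_def
  proof (rule wp_Seq)
    show "wp (Store (reg_at c) (Const 0)) (2 * unit_cost) (I 0) v \<mu> T"
      using c init by (intro wp_Store_reg) (auto simp: small_defs)
  qed (rule loop, auto)
  then show ?thesis by (rule wp_mono) (auto simp: loop_time_def)
qed

lemma small_simps [simp]:
  "small pair_cond" "small join_cond" "small move_cond" "small row_cond" "small result"
  "c < 9 \<Longrightarrow> small (reg c)" "c < 9 \<Longrightarrow> small (weight_at (reg c))"
  "c < 9 \<Longrightarrow> small (Mult (Const 2) (reg c))" "c < 9 \<Longrightarrow> small (Mult (Const 4) (reg c))"
  "c < 9 \<Longrightarrow> small (Add (reg c) (Const 1))" "small (Const 0)" "small (Const 1)"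
  "c < 9 \<Longrightarrow> small (Add (reg c) (Const (Suc 0)))" "small (Const (Suc 0))"
  "c < 9 \<Longrightarrow> d < 9 \<Longrightarrow> small (Sub (reg c) (reg d))"
  "c < 9 \<Longrightarrow> d < 9 \<Longrightarrow> small (Add (reg c) (reg d))"
  "c < 9 \<Longrightarrow> d < 9 \<Longrightarrow> small (Add (reg c) (weight (reg d)))"
  "c < 9 \<Longrightarrow> small (Sub num_m (reg c))" "c < 9 \<Longrightarrow> small (Sub num_n (reg c))"
  "small (table_at (Const 0))"
  "c < 9 \<Longrightarrow> d < 9 \<Longrightarrow> e < 9 \<Longrightarrow> small (table_at (Add (reg c) (Add (reg d) (reg e))))"
  by (simp_all add: small_defs)

section \<open>Pairing intersecting edges\<close>

text \<open>
  A marked edge carries the weight \<open>2 ^ b\<close>, an unmarked one the weight \<open>0\<close>; the marked edges with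
  weights \<open>2 ^ (2 * a)\<close> and \<open>2 ^ (2 * a + 1)\<close> form the pair number \<open>a\<close>.
\<close>

definition matching :: "nat \<Rightarrow> (nat \<Rightarrow> nat) \<Rightarrow> bool" where
  "matching p \<mu> \<longleftrightarrow> p \<le> k
     \<and> (\<forall>i<m. \<mu> i \<noteq> 0 \<longrightarrow> (\<exists>b<2 * p. \<mu> i = 2 ^ b))
     \<and> (\<forall>b<2 * p. \<exists>i<m. \<mu> i = 2 ^ b)
     \<and> (\<forall>i<m. \<forall>j<m. \<mu> i = \<mu> j \<longrightarrow> \<mu> i \<noteq> 0 \<longrightarrow> i = j)
     \<and> (\<forall>a<p. \<exists>x<n. \<exists>i<m. \<exists>j<m. \<mu> i = 2 ^ (2 * a) \<and> \<mu> j = 2 ^ (2 * a + 1) \<and> inc i x \<and> inc j x)"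

text \<open>\<open>S\<close> collects the triples inspected so far. Later marking only removes
  unmarked edges and thus preserves the property, which is why a single greedy pass
  suffices.\<close>

definition unmarked_disjoint :: "(nat \<times> nat \<times> nat) set \<Rightarrow> (nat \<Rightarrow> nat) \<Rightarrow> bool" where
  "unmarked_disjoint S \<mu> \<longleftrightarrow>
     (\<forall>(i, j, x)\<in>S. \<mu> i = 0 \<longrightarrow> \<mu> j = 0 \<longrightarrow> \<not> (inc i x \<and> inc j x))"

text \<open>The new exponents \<open>2 * p\<close> and \<open>2 * p + 1\<close> lie just above all
  old ones, hence injectivity; both edges were unmarked, hence no old pair is overwritten.\<close>

lemma matching_extend:
  assumes M: "matching p \<mu>" and "p < k" "i < m" "j < m" "i \<noteq> j" "x < n"
    and z: "\<mu> i = 0" "\<mu> j = 0" and x: "inc i x" "inc j x"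
  shows "matching (Suc p) (\<mu>(i := 4 ^ p, j := 2 * 4 ^ p))" (is "matching _ ?\<mu>")
proof -
  have e: "(4::nat) ^ p = 2 ^ (2 * p)" "2 * (4::nat) ^ p = 2 ^ (2 * p + 1)"
    by (simp_all add: power_mult)
  have new: "\<mu> l \<noteq> 2 ^ b" if "l < m" "b \<ge> 2 * p" for l b
    using M that unfolding matching_def by (metis linorder_not_less power_inject_exp one_less_numeral_iff
        semiring_norm(76) power_not_zero zero_neq_numeral)
  have val: "?\<mu> l = (if l = j then 2 ^ (2 * p + 1) else if l = i then 2 ^ (2 * p) else \<mu> l)" for l
    using e by simp
  have old: "?\<mu> l = \<mu> l" if "\<mu> l \<noteq> 0" for l using z that by auto
  have exp: "\<exists>b<2 * Suc p. ?\<mu> l = 2 ^ b" if "l < m" "?\<mu> l \<noteq> 0" for l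
  proof (cases "l = i \<or> l = j")
    case True
    then have "?\<mu> l = 2 ^ (2 * p + 1) \<or> ?\<mu> l = 2 ^ (2 * p)" using val by auto
    moreover have "2 * p + 1 < 2 * Suc p" "2 * p < 2 * Suc p" by auto
    ultimately show ?thesis by blast
  next
    case False
    then obtain b where "b < 2 * p" "?\<mu> l = 2 ^ b" using M \<open>l < m\<close> \<open>?\<mu> l \<noteq> 0\<close>
      unfolding matching_def by auto
    then show ?thesis by (intro exI[of _ b]) auto
  qed
  have surj: "\<exists>l<m. ?\<mu> l = 2 ^ b" if b: "b < 2 * Suc p" for b
  proof -
    have "b < 2 * p \<or> b = 2 * p \<or> b = 2 * p + 1" using b by arith
    then consider "b < 2 * p" | "b = 2 * p" | "b = 2 * p + 1" by blast
    then show ?thesis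
    proof cases
      case 1
      then obtain l where "l < m" "\<mu> l = 2 ^ b" using M unfolding matching_def by blast
      then show ?thesis using old[of l] by auto
    next
      case 2
      then show ?thesis using val[of i] assms by auto
    next
      case 3
      then show ?thesis using val[of j] assms by metis
    qed
  qed
  have inj: "l = l'" if l: "l < m" "l' < m" "?\<mu> l = ?\<mu> l'" "?\<mu> l \<noteq> 0" for l l'
  proof -
    have "(2::nat) ^ (2 * p + 1) \<noteq> 2 ^ (2 * p)" by simp
    moreover have "\<mu> l = \<mu> l' \<Longrightarrow> \<mu> l \<noteq> 0 \<Longrightarrow> l = l'" using M l unfolding matching_def by blast
    ultimately show ?thesis
      using l(3,4) new[OF l(1), of "2 * p"] new[OF l(1), of "2 * p + 1"]
        new[OF l(2), of "2 * p"] new[OF l(2), of "2 * p + 1"]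
      unfolding val by (auto split: if_splits)
  qed
  have pairs: "\<exists>y<n. \<exists>l<m. \<exists>l'<m. ?\<mu> l = 2 ^ (2 * a) \<and> ?\<mu> l' = 2 ^ (2 * a + 1) \<and> inc l y \<and> inc l' y"
    if a: "a < Suc p" for a
  proof (cases "a < p")
    case True
    then obtain y l l' where y: "y < n" "l < m" "l' < m" "\<mu> l = 2 ^ (2 * a)" "\<mu> l' = 2 ^ (2 * a + 1)"
      "inc l y" "inc l' y" using M unfolding matching_def by blast
    then have "?\<mu> l = 2 ^ (2 * a)" "?\<mu> l' = 2 ^ (2 * a + 1)" using old[of l] old[of l'] by auto
    with y show ?thesis by blast
  next
    case False
    then have "a = p" using a by simp
    have "?\<mu> i = 4 ^ p" "?\<mu> j = 2 * 4 ^ p" using assms(5) by simp_all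
    note this(1)[THEN trans, OF e(1)] this(2)[THEN trans, OF e(2)]
    then show ?thesis unfolding \<open>a = p\<close>
      by (intro exI[of _ x] exI[of _ i] exI[of _ j] conjI assms)
  qed
  show ?thesis
    unfolding matching_def
  proof (intro conjI allI impI)
    show "Suc p \<le> k" using \<open>p < k\<close> by simp
  qed (rule exp surj inj pairs; assumption)+
qed

lemma matching_empty: "matching 0 (\<lambda>_. 0)"
  by (simp add: matching_def)

text \<open>Disjointness is claimed only while fewer than \<open>k\<close> pairs exist: afterwards
  \<open>pair_cond\<close> fails for every triple and says nothing about the edges.\<close>

definition pair_inv where
  "pair_inv S v \<mu> T \<longleftrightarrow> bounded v \<mu> T \<and> T = (\<lambda>_. 0) \<and> v rR = 0 \<and> v rC = 0 \<and>
     v rW = 4 ^ v rP \<and> matching (v rP) \<mu> \<and> (v rP < k \<longrightarrow> unmarked_disjoint S \<mu>)"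

lemma pair_inv_update:
  "pair_inv S v \<mu> T \<Longrightarrow> c \<in> {rI, rJ, rV} \<Longrightarrow> x \<le> m + n \<Longrightarrow> pair_inv S (v(c := x)) \<mu> T"
  unfolding pair_inv_def by (auto intro!: bounded_reg small_le_bits)

lemma pair_step_correct:
  assumes inv: "pair_inv S v \<mu> T" and v: "v rI < m" "v rJ < v rI" "v rV < n"
  shows "wp pair_step (9 * unit_cost) (\<lambda>v' \<mu> T. pair_inv (insert (v rI, v rJ, v rV) S) v' \<mu> T
     \<and> (\<forall>c\<in>{rI, rJ, rV}. v' c = v c)) v \<mu> T"
proof -
  let ?i = "v rI" and ?j = "v rJ" and ?x = "v rV" and ?p = "v rP"
  have b: "bounded v \<mu> T" and W: "v rW = 4 ^ ?p" and M: "matching ?p \<mu>"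
    and T: "T = (\<lambda>_. 0)" "v rR = 0" "v rC = 0" and ud: "?p < k \<longrightarrow> unmarked_disjoint S \<mu>"
    using inv by (auto simp: pair_inv_def)
  have cond: "val (mem v \<mu> T) pair_cond \<noteq> 0 \<longleftrightarrow>
      inc ?i ?x \<and> inc ?j ?x \<and> ?p < k \<and> \<mu> ?i = 0 \<and> \<mu> ?j = 0"
    unfolding pair_cond_def using v by auto
  have "wp pair_step (unit_cost + (2 * unit_cost + (2 * unit_cost + (2 * unit_cost + 2 * unit_cost))))
     (\<lambda>v' \<mu> T. pair_inv (insert (v rI, v rJ, v rV) S) v' \<mu> T \<and> (\<forall>c\<in>{rI, rJ, rV}. v' c = v c)) v \<mu> T"
    unfolding pair_step_def
  proof (rule wp_If)
    assume "val (mem v \<mu> T) pair_cond \<noteq> 0"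
    then have c: "inc ?i ?x" "inc ?j ?x" "?p < k" "\<mu> ?i = 0" "\<mu> ?j = 0" using cond by auto
    have p4: "(4::nat) ^ ?p \<le> 4 ^ k" "4 * (4::nat) ^ ?p \<le> 4 ^ k"
      using power_increasing[of ?p k "4::nat"] power_increasing[of "Suc ?p" k "4::nat"] c(3) by auto
    have le: "4 * (4::nat) ^ ?p \<le> 2 ^ bits" by (rule le_bits[of _ 0]) (use p4 in auto)
    have le': "(4::nat) ^ ?p \<le> 2 ^ bits" "2 * (4::nat) ^ ?p \<le> 2 ^ bits" "Suc ?p \<le> 2 ^ bits"
      using le c(3) k_le_bits by linarith+
    let ?\<mu> = "\<mu>(?i := 4 ^ ?p, ?j := 2 * 4 ^ ?p)"
    have "matching (Suc ?p) ?\<mu>" using v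
      by (intro matching_extend[OF M c(3) _ _ _ _ c(4,5) c(1,2)]) auto
    moreover have "unmarked_disjoint (insert (?i, ?j, ?x) S) ?\<mu>"
    proof -
      \<comment> \<open>The new weights are nonzero, so whatever is unmarked now was unmarked
        before. As \<open>?i\<close> is marked now, the new triple satisfies the condition
        vacuously.\<close>
      have z: "\<mu> l = 0 \<and> l \<noteq> ?i" if "?\<mu> l = 0" for l
        using that by (cases "l = ?j"; cases "l = ?i") simp_all
      show ?thesis unfolding unmarked_disjoint_def
      proof (intro ballI, clarify)
        fix a b y assume *: "(a, b, y) \<in> insert (?i, ?j, ?x) S" "?\<mu> a = 0" "?\<mu> b = 0" "inc a y" "inc b y"
        then have "(a, b, y) \<in> S" using z[of a] by blast
        then show False
          using ud c(3) z[OF *(2)] z[OF *(3)] *(4,5) unfolding unmarked_disjoint_def by blast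
      qed
    qed
    ultimately show "wp (Seq (Store (weight_at (reg rI)) (reg rW))
       (Seq (Store (weight_at (reg rJ)) (Mult (Const 2) (reg rW)))
       (Seq (Store (reg_at rW) (Mult (Const 4) (reg rW)))
            (Store (reg_at rP) (Add (reg rP) (Const 1))))))
       (2 * unit_cost + (2 * unit_cost + (2 * unit_cost + 2 * unit_cost)))
     (\<lambda>v' \<mu> T. pair_inv (insert (v rI, v rJ, v rV) S) v' \<mu> T \<and> (\<forall>c\<in>{rI, rJ, rV}. v' c = v c)) v \<mu> T"
      using v W T b le le' unfolding pair_inv_def
      by (intro wp_Seq_backward wp_Store_weight wp_Store_reg) (simp_all add: bounded_reg bounded_weight)
  next
    assume "val (mem v \<mu> T) pair_cond = 0"
    then have c: "\<not> (inc ?i ?x \<and> inc ?j ?x \<and> ?p < k \<and> \<mu> ?i = 0 \<and> \<mu> ?j = 0)" using cond by auto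
    have "pair_inv (insert (?i, ?j, ?x) S) v \<mu> T"
      using inv c unfolding pair_inv_def unmarked_disjoint_def by auto
    then have "wp Skip unit_cost
     (\<lambda>v' \<mu> T. pair_inv (insert (v rI, v rJ, v rV) S) v' \<mu> T \<and> (\<forall>c\<in>{rI, rJ, rV}. v' c = v c)) v \<mu> T"
      by (intro wp_Skip) auto
    then show "wp Skip (2 * unit_cost + (2 * unit_cost + (2 * unit_cost + 2 * unit_cost)))
     (\<lambda>v' \<mu> T. pair_inv (insert (v rI, v rJ, v rV) S) v' \<mu> T \<and> (\<forall>c\<in>{rI, rJ, rV}. v' c = v c)) v \<mu> T"
      by (rule wp_mono) auto
  qed (use b in auto)
  then show ?thesis by (rule wp_mono) auto
qed

definition pair_time :: nat where
  "pair_time = 2 * unit_cost + loop_time m (loop_time m (loop_time n (9 * unit_cost)))"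

lemma loop_time_mono: "N \<le> N' \<Longrightarrow> t \<le> t' \<Longrightarrow> loop_time N t \<le> loop_time N' t'"
  unfolding loop_time_def by (intro add_mono mult_mono) auto

lemma pair_phase_correct:
  "wp pair_phase pair_time (\<lambda>v \<mu> T. pair_inv {(i, j, x). i < m \<and> j < i \<and> x < n} v \<mu> T)
     (\<lambda>_. 0) (\<lambda>_. 0) (\<lambda>_. 0)"
proof -
  \<comment> \<open>These are the triples lexicographically below the loop counters; the equations
    in \<open>sets\<close> turn a finished inner loop into one step of the loop around it.\<close>
  define A :: "nat \<Rightarrow> (nat \<times> nat \<times> nat) set" where "A i = {(i', j, x). i' < i \<and> j < i' \<and> x < n}" for i
  define B where "B i j = A i \<union> {(i', j', x). i' = i \<and> j' < j \<and> x < n}" for i j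
  define D where "D i j x = B i j \<union> {(i', j', x'). i' = i \<and> j' = j \<and> x' < x}" for i j x
  have sets: "A 0 = {}" "B i 0 = A i" "B i i = A (Suc i)" "D i j 0 = B i j" "D i j n = B i (Suc j)"
    "insert (i, j, x) (D i j x) = D i j (Suc x)" for i j x
    by (auto simp: A_def B_def D_def less_Suc_eq)
  let ?I = "\<lambda>i v \<mu> T. pair_inv (A i) v \<mu> T \<and> v rI = i"
  let ?J = "\<lambda>i j v \<mu> T. pair_inv (B i j) v \<mu> T \<and> v rI = i \<and> v rJ = j"
  let ?X = "\<lambda>i j x v \<mu> T. pair_inv (D i j x) v \<mu> T \<and> v rI = i \<and> v rJ = j \<and> v rV = x"
  note upd = pair_inv_update
  have bd: "bounded v \<mu> T" if "pair_inv S v \<mu> T" for S v \<mu> T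
    using that unfolding pair_inv_def by blast
  have inner: "wp (For rV num_n pair_step) (loop_time n (9 * unit_cost)) (?X i j n) v \<mu> T"
    if "?J i j v \<mu> T" "i < m" "j < i" for i j v \<mu> T
  proof (rule wp_For[where I = "?X i j"])
    show "?X i j 0 (v(rV := 0)) \<mu> T" using that by (auto simp: sets intro: upd)
  next
    fix x v \<mu> T assume x: "x < n" and X: "?X i j x v \<mu> T"
    show "wp pair_step (9 * unit_cost)
       (\<lambda>v \<mu> T. bounded v \<mu> T \<and> v rV = x \<and> ?X i j (Suc x) (v(rV := Suc x)) \<mu> T) v \<mu> T"
    proof (rule wp_mono[OF pair_step_correct])
      show "pair_inv (D i j x) v \<mu> T" using X by blast
      fix v' \<mu>' T'
      assume "pair_inv (insert (v rI, v rJ, v rV) (D i j x)) v' \<mu>' T' \<and> (\<forall>c\<in>{rI, rJ, rV}. v' c = v c)"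
      then show "bounded v' \<mu>' T' \<and> v' rV = x \<and> ?X i j (Suc x) (v'(rV := Suc x)) \<mu>' T'"
        using X x by (auto simp: sets intro: upd bd)
    qed (use X x that in auto)
  qed (use that bd in auto)
  have middle: "wp (For rJ (reg rI) (For rV num_n pair_step))
      (loop_time i (loop_time n (9 * unit_cost))) (?J i i) v \<mu> T"
    if "?I i v \<mu> T" "i < m" for i v \<mu> T
  proof (rule wp_For[where I = "?J i"])
    show "?J i 0 (v(rJ := 0)) \<mu> T" using that by (auto simp: sets intro: upd)
  next
    fix j v \<mu> T assume j: "j < i" and J: "?J i j v \<mu> T"
    show "wp (For rV num_n pair_step) (loop_time n (9 * unit_cost))
       (\<lambda>v \<mu> T. bounded v \<mu> T \<and> v rJ = j \<and> ?J i (Suc j) (v(rJ := Suc j)) \<mu> T) v \<mu> T"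
    proof (rule wp_mono[OF inner[OF J that(2) j] order_refl])
      fix v \<mu> T assume X: "?X i j n v \<mu> T"
      then have "pair_inv (B i (Suc j)) v \<mu> T" by (simp add: sets)
      with bd[OF this] X j that(2)
      show "bounded v \<mu> T \<and> v rJ = j \<and> ?J i (Suc j) (v(rJ := Suc j)) \<mu> T"
        by (simp add: upd)
    qed
  qed (use that bd in auto)
  have outer: "wp (For rI num_m (For rJ (reg rI) (For rV num_n pair_step)))
      (loop_time m (loop_time m (loop_time n (9 * unit_cost)))) (?I m) v \<mu> T"
    if "pair_inv {} v \<mu> T" for v \<mu> T
  proof (rule wp_For[where I = "?I"])
    show "?I 0 (v(rI := 0)) \<mu> T" using that by (auto simp: sets intro: upd)
  next
    fix i v \<mu> T assume i: "i < m" and I: "?I i v \<mu> T"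
    show "wp (For rJ (reg rI) (For rV num_n pair_step)) (loop_time m (loop_time n (9 * unit_cost)))
       (\<lambda>v \<mu> T. bounded v \<mu> T \<and> v rI = i \<and> ?I (Suc i) (v(rI := Suc i)) \<mu> T) v \<mu> T"
      by (rule wp_mono[OF middle[OF I i]])
        (use i in \<open>auto simp: sets intro!: upd bd loop_time_mono\<close>)
  qed (use that bd in auto)
  have "wp pair_phase pair_time (?I m) (\<lambda>_. 0) (\<lambda>_. 0) (\<lambda>_. 0)"
    unfolding pair_phase_def pair_time_def
  proof (rule wp_Seq)
    have "bounded (\<lambda>_. 0) (\<lambda>_. 0) (\<lambda>_. 0)" by (simp add: bounded_def)
    moreover from this have "pair_inv {} ((\<lambda>_. 0)(rW := 1)) (\<lambda>_. 0) (\<lambda>_. 0)"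
      by (auto simp: pair_inv_def unmarked_disjoint_def matching_empty intro: bounded_reg)
    ultimately show "wp (Store (reg_at rW) (Const 1)) (2 * unit_cost) (pair_inv {})
        (\<lambda>_. 0) (\<lambda>_. 0) (\<lambda>_. 0)"
      by (intro wp_Store_reg) auto
  qed (rule outer)
  then show ?thesis by (rule wp_mono) (auto simp: A_def)
qed

section \<open>The dynamic program\<close>

text \<open>A set of marked edges is encoded by the sum of their weights.\<close>

primrec join :: "(nat \<Rightarrow> nat) \<Rightarrow> nat \<Rightarrow> nat \<Rightarrow> nat \<Rightarrow> nat" where
  "join \<mu> x 0 Y = Y"
| "join \<mu> x (Suc j) Y = join \<mu> x j Y +
     (if \<mu> j \<noteq> 0 \<and> inc j x \<and> even (join \<mu> x j Y div \<mu> j) then \<mu> j else 0)"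

definition weights_below :: "nat \<Rightarrow> (nat \<Rightarrow> nat) \<Rightarrow> bool" where
  "weights_below q \<mu> \<longleftrightarrow> (\<forall>i<m. \<mu> i \<noteq> 0 \<longrightarrow> (\<exists>b<q. \<mu> i = 2 ^ b))"

text \<open>Adding \<open>2 ^ c\<close> only when bit \<open>c\<close> is clear produces no carry
  and equals \<open>set_bit c\<close>. Hence \<open>join\<close> is the union with the marked edges
  through \<open>x\<close>.\<close>

lemma bit_join:
  assumes "weights_below q \<mu>" "j \<le> m"
  shows "bit (join \<mu> x j Y) b \<longleftrightarrow> bit Y b \<or> (\<exists>j'<j. \<mu> j' = 2 ^ b \<and> inc j' x)"
  using assms(2)
proof (induction j)
  case 0
  then show ?case by simp
next
  case (Suc j)
  let ?Z = "join \<mu> x j Y"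
  show ?case
  proof (cases "\<mu> j = 0 \<or> \<not> inc j x")
    case True
    then have "join \<mu> x (Suc j) Y = ?Z" by auto
    with True Suc show ?thesis by (auto simp: less_Suc_eq)
  next
    case False
    then obtain c where c: "\<mu> j = 2 ^ c"
      using assms(1) Suc.prems unfolding weights_below_def by (meson Suc_le_lessD)
    have "join \<mu> x (Suc j) Y = ?Z + of_bool (\<not> bit ?Z c) * 2 ^ c"
      using False c by (auto simp: bit_iff_odd)
    also have "\<dots> = set_bit c ?Z" by (simp add: set_bit_eq)
    finally have "join \<mu> x (Suc j) Y = set_bit c ?Z" .
    then have "bit (join \<mu> x (Suc j) Y) b \<longleftrightarrow> bit ?Z b \<or> b = c"
      by (auto simp: bit_set_bit_iff)
    with Suc False c show ?thesis by (auto simp: less_Suc_eq)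
  qed
qed

lemma less_exp_iff_bits: "(Y::nat) < 2 ^ q \<longleftrightarrow> (\<forall>b\<ge>q. \<not> bit Y b)"
proof -
  have "take_bit q Y = Y \<longleftrightarrow> (\<forall>b\<ge>q. \<not> bit Y b)"
  proof
    assume *: "take_bit q Y = Y"
    have "\<not> bit (take_bit q Y) b" if "b \<ge> q" for b using that by (simp add: bit_take_bit_iff)
    then show "\<forall>b\<ge>q. \<not> bit Y b" unfolding * by blast
  next
    assume *: "\<forall>b\<ge>q. \<not> bit Y b"
    show "take_bit q Y = Y"
    proof (rule bit_eqI)
      show "bit (take_bit q Y) b \<longleftrightarrow> bit Y b" for b
        using * by (cases "b < q") (auto simp: bit_take_bit_iff)
    qed
  qed
  then show ?thesis by (simp add: take_bit_nat_eq_self_iff)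
qed

lemma join_less:
  assumes "weights_below q \<mu>" "j \<le> m" "Y < 2 ^ q"
  shows "join \<mu> x j Y < 2 ^ q"
proof -
  have "\<not> bit (join \<mu> x j Y) b" if "b \<ge> q" for b
  proof -
    have "\<not> (\<exists>j'<j. \<mu> j' = 2 ^ b \<and> inc j' x)"
    proof
      assume "\<exists>j'<j. \<mu> j' = 2 ^ b \<and> inc j' x"
      then obtain j' where "j' < j" and j'b: "\<mu> j' = 2 ^ b" by blast
      with assms(2) have "j' < m" by simp
      with j'b obtain c where "c < q" "(2::nat) ^ b = 2 ^ c"
        using assms(1) unfolding weights_below_def by force
      then show False using that by (simp add: power_inject_exp)
    qed
    then show ?thesis using assms that by (auto simp: bit_join less_exp_iff_bits)
  qed
  then show ?thesis by (simp add: less_exp_iff_bits)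
qed

text \<open>
  Every hitting set of size \<open>m - k\<close> is enumerated with one vertex per row. An unmarked edge
  gives a row whose vertex comes from that edge, and the marked edges except for the first \<open>k\<close>
  give rows with an arbitrary vertex.
\<close>

definition row :: "(nat \<Rightarrow> nat) \<Rightarrow> nat \<Rightarrow> bool" where
  "row \<mu> i \<longleftrightarrow> \<mu> i = 0 \<or> k \<le> card {j. j < i \<and> \<mu> j \<noteq> 0}"

primrec reach :: "(nat \<Rightarrow> nat) \<Rightarrow> nat \<Rightarrow> nat set" where
  "reach \<mu> 0 = {0}"
| "reach \<mu> (Suc i) = (if row \<mu> i
     then {join \<mu> x m X | x X. X \<in> reach \<mu> i \<and> x < n \<and> (inc i x \<or> \<mu> i \<noteq> 0)}
     else reach \<mu> i)"

definition join_time :: nat where "join_time = loop_time m (3 * unit_cost)"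

lemma join_loop_correct:
  assumes b: "bounded v \<mu> T" and W: "weights_below q \<mu>" and q: "2 ^ q \<le> (2::nat) ^ bits"
    and v: "v rY < 2 ^ q" "v rV < n"
  shows "wp (For rJ num_m join_step) join_time (\<lambda>v' \<mu>' T'. bounded v' \<mu>' T' \<and> \<mu>' = \<mu> \<and> T' = T \<and>
     v' rY = join \<mu> (v rV) m (v rY) \<and> (\<forall>c\<in>{rW, rI, rV, rX, rR, rC}. v' c = v c)) v \<mu> T"
proof -
  have parity: "Suc 0 - (D - 2 * (D div 2)) = of_bool (even D)" for D :: nat
    by (cases "even D") (auto elim!: oddE)
  let ?I = "\<lambda>j v' \<mu>' T'. bounded v' \<mu>' T' \<and> \<mu>' = \<mu> \<and> T' = T \<and> v' rJ = j \<and>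
     v' rY = join \<mu> (v rV) j (v rY) \<and> (\<forall>c\<in>{rW, rI, rV, rX, rR, rC}. v' c = v c)"
  have "wp (For rJ num_m join_step) (loop_time m (3 * unit_cost)) (?I m) v \<mu> T"
  proof (rule wp_For[where I = ?I])
    fix j v' \<mu>' T' assume j: "j < m" and I: "?I j v' \<mu>' T'"
    let ?Q = "\<lambda>v \<mu> T. bounded v \<mu> T \<and> v rJ = j \<and> ?I (Suc j) (v(rJ := Suc j)) \<mu> T"
    have J: "v' rJ = j" "\<mu>' = \<mu>" "v' rV = v rV" "bounded v' \<mu> T" "T' = T" using I by auto
    have sj: "Suc j \<le> 2 ^ bits" by (rule small_le_bits) (use j in simp)
    have less: "join \<mu> (v rV) (Suc j) (v rY) \<le> 2 ^ bits"
      using join_less[OF W _ v(1), of "Suc j" "v rV"] q j by linarith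
    have cond: "val (mem v' \<mu>' T') join_cond \<noteq> 0 \<longleftrightarrow>
        \<mu> j \<noteq> 0 \<and> inc j (v rV) \<and> even (v' rY div \<mu> j)"
      unfolding join_cond_def quot_def using J j v(2) by (auto simp: parity)
    have "wp join_step (unit_cost + 2 * unit_cost) ?Q v' \<mu>' T'"
      unfolding join_step_def
    proof (rule wp_If)
      assume "val (mem v' \<mu>' T') join_cond \<noteq> 0"
      then have c: "\<mu> j \<noteq> 0 \<and> inc j (v rV) \<and> even (join \<mu> (v rV) j (v rY) div \<mu> j)"
        using cond I by auto
      then have "join \<mu> (v rV) j (v rY) + \<mu> j = join \<mu> (v rV) (Suc j) (v rY)" by simp
      then show "wp (Store (reg_at rY) (Add (reg rY) (weight (reg rJ)))) (2 * unit_cost) ?Q v' \<mu>' T'"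
        using I j less sj by (intro wp_Store_reg) (auto simp del: join.simps intro!: bounded_reg)
    next
      assume "val (mem v' \<mu>' T') join_cond = 0"
      then have "\<not> (\<mu> j \<noteq> 0 \<and> inc j (v rV) \<and> even (join \<mu> (v rV) j (v rY) div \<mu> j))"
        using cond I by auto
      then have "join \<mu> (v rV) (Suc j) (v rY) = join \<mu> (v rV) j (v rY)" by auto
      then have "wp Skip unit_cost ?Q v' \<mu>' T'"
        using I j sj by (intro wp_Skip) (auto simp del: join.simps intro!: bounded_reg)
      then show "wp Skip (2 * unit_cost) ?Q v' \<mu>' T'" by (rule wp_mono) auto
    qed (use I in auto)
    then show "wp join_step (3 * unit_cost) ?Q v' \<mu>' T'" by (rule wp_mono) auto
  qed (use b in \<open>auto intro!: bounded_reg\<close>)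
  then show ?thesis unfolding join_time_def by (rule wp_mono) auto
qed

section \<open>Filling the table row by row\<close>

definition move :: "(nat \<Rightarrow> nat) \<Rightarrow> nat \<Rightarrow> nat \<Rightarrow> nat \<Rightarrow> (nat \<Rightarrow> nat) \<Rightarrow> nat \<Rightarrow> nat \<Rightarrow> nat \<Rightarrow> bool" where
  "move \<mu>0 q i R T0 X x a \<longleftrightarrow> T0 (R + X) \<noteq> 0 \<and> (inc i x \<or> \<mu>0 i \<noteq> 0) \<and> a = R + 2 ^ q + join \<mu>0 x m X"

text \<open>\<open>T0\<close> is the table before the row is filled and \<open>S\<close> the set of
  pairs treated so far. Reads go below \<open>R + 2 ^ q\<close> and writes at or above it, so all
  reads see \<open>T0\<close>. For \<open>S = {}\<close> the last clause says that the cells of the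
  new row and behind it are \<open>0\<close>.\<close>

definition fill_inv where
  "fill_inv \<mu>0 q i c R T0 S v \<mu> T \<longleftrightarrow> bounded v \<mu> T \<and> \<mu> = \<mu>0 \<and> v rW = 2 ^ q \<and> v rI = i \<and>
     v rC = c \<and> v rR = R \<and> (\<forall>a<R + 2 ^ q. T a = T0 a) \<and>
     (\<forall>a\<ge>R + 2 ^ q. T a = of_bool (\<exists>(X, x)\<in>S. move \<mu>0 q i R T0 X x a))"

lemma fill_invD:
  assumes "fill_inv \<mu>0 q i c R T0 S v \<mu> T"
  shows "bounded v \<mu> T" "\<mu> = \<mu>0" "v rW = 2 ^ q" "v rI = i" "v rC = c" "v rR = R"
    "\<forall>a<R + 2 ^ q. T a = T0 a"
    "\<forall>a\<ge>R + 2 ^ q. T a = of_bool (\<exists>(X, x)\<in>S. move \<mu>0 q i R T0 X x a)"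
  using assms unfolding fill_inv_def by - (elim conjE, assumption)+

lemma fill_inv_update:
  "fill_inv \<mu>0 q i c R T0 S v \<mu> T \<Longrightarrow> d \<in> {rJ, rV, rX, rY} \<Longrightarrow> x \<le> 2 ^ bits \<Longrightarrow>
   fill_inv \<mu>0 q i c R T0 S (v(d := x)) \<mu> T"
  unfolding fill_inv_def by (auto intro!: bounded_reg)

lemma fill_inv_regs:
  assumes "fill_inv \<mu>0 q i c R T0 S v \<mu> T" "bounded v' \<mu> T" "\<forall>c\<in>{rW, rI, rC, rR}. v' c = v c"
  shows "fill_inv \<mu>0 q i c R T0 S v' \<mu> T"
  using assms by (simp add: fill_inv_def)

lemma fill_inv_skip:
  assumes inv: "fill_inv \<mu>0 q i c R T0 S v \<mu> T" and no: "\<not> (T0 (R + X) \<noteq> 0 \<and> (inc i x \<or> \<mu>0 i \<noteq> 0))"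
  shows "fill_inv \<mu>0 q i c R T0 (insert (X, x) S) v \<mu> T"
proof -
  have "\<not> move \<mu>0 q i R T0 X x a" for a using no by (auto simp: move_def)
  moreover note fill_invD(2)[OF inv]
  ultimately show ?thesis using inv by (simp add: fill_inv_def)
qed

lemma fill_inv_hit:
  assumes inv: "fill_inv \<mu>0 q i c R T0 S v \<mu> T" and yes: "T0 (R + X) \<noteq> 0 \<and> (inc i x \<or> \<mu>0 i \<noteq> 0)"
  shows "fill_inv \<mu>0 q i c R T0 (insert (X, x) S) v \<mu> (T(R + 2 ^ q + join \<mu>0 x m X := 1))"
proof -
  have *: "move \<mu>0 q i R T0 X x a \<longleftrightarrow> a = R + 2 ^ q + join \<mu>0 x m X" for a
    using yes by (simp add: move_def)
  have "bounded v \<mu> (T(R + 2 ^ q + join \<mu>0 x m X := 1))"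
    by (intro bounded_table fill_invD(1)[OF inv]) simp
  moreover note fill_invD(2)[OF inv]
  ultimately show ?thesis using inv by (simp add: fill_inv_def *)
qed

definition move_time :: nat where "move_time = 5 * unit_cost + join_time"

lemma move_step_correct:
  assumes W: "weights_below q \<mu>0" and q: "2 ^ q \<le> (2::nat) ^ bits"
    and inv: "fill_inv \<mu>0 q i c R T0 S v \<mu> T" and v: "v rX = X" "v rV = x" "X < 2 ^ q" "x < n" "i < m"
  shows "wp move_step move_time (\<lambda>v' \<mu>' T'. fill_inv \<mu>0 q i c R T0 (insert (X, x) S) v' \<mu>' T' \<and>
     v' rX = X \<and> v' rV = x) v \<mu> T"
proof -
  let ?Q = "\<lambda>v' \<mu>' T'. fill_inv \<mu>0 q i c R T0 (insert (X, x) S) v' \<mu>' T' \<and> v' rX = X \<and> v' rV = x"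
  note w = fill_invD(3-6)[OF inv] and \<mu> = fill_invD(2)[OF inv]
  have T: "T a = T0 a" if "a < R + 2 ^ q" for a using fill_invD(7)[OF inv] that by blast
  have b: "bounded v \<mu>0 T" using fill_invD(1)[OF inv] \<mu> by simp
  have cond: "val (mem v \<mu> T) move_cond \<noteq> 0 \<longleftrightarrow> T0 (R + X) \<noteq> 0 \<and> (inc i x \<or> \<mu>0 i \<noteq> 0)"
    unfolding move_cond_def using v w \<mu> T[of "R + X"] by auto
  have Xb: "X \<le> 2 ^ bits" using v(3) q by linarith
  have "wp move_step (unit_cost + (2 * unit_cost + (join_time + 2 * unit_cost))) ?Q v \<mu> T"
    unfolding move_step_def
  proof (rule wp_If)
    assume "val (mem v \<mu> T) move_cond \<noteq> 0"
    then have c: "T0 (R + X) \<noteq> 0 \<and> (inc i x \<or> \<mu>0 i \<noteq> 0)" using cond by blast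
    let ?j = "R + 2 ^ q + join \<mu>0 x m X"
    have "wp (For rJ num_m join_step) join_time (\<lambda>v' \<mu>' T'. bounded v' \<mu>' T' \<and> \<mu>' = \<mu>0 \<and> T' = T \<and>
       v' rY = join \<mu>0 x m X \<and> (\<forall>c\<in>{rW, rI, rV, rX, rR, rC}. v' c = v c)) (v(rY := X)) \<mu>0 T"
      by (rule wp_mono[OF join_loop_correct[OF _ W q]]) (use v b Xb in \<open>auto intro: bounded_reg\<close>)
    then have "wp (Seq (For rJ num_m join_step)
        (Store (table_at (Add (reg rR) (Add (reg rW) (reg rY)))) (Const 1)))
        (join_time + 2 * unit_cost) ?Q (v(rY := X)) \<mu>0 T"
    proof (rule wp_Seq)
      fix v' \<mu>' T'
      assume *: "bounded v' \<mu>' T' \<and> \<mu>' = \<mu>0 \<and> T' = T \<and>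
        v' rY = join \<mu>0 x m X \<and> (\<forall>c\<in>{rW, rI, rV, rX, rR, rC}. v' c = v c)"
      then have eqs: "\<mu>' = \<mu>0" "T' = T" "v' rY = join \<mu>0 x m X"
        and regs: "\<forall>c\<in>{rW, rI, rC, rR}. v' c = v c" "v' rX = X" "v' rV = x"
        using v by simp_all
      have "v' rR = R" "v' rW = 2 ^ q" using regs(1) w by simp_all
      then have at: "val (mem v' \<mu>' T') (Add (reg rR) (Add (reg rW) (reg rY))) = ?j"
        using eqs(3) by simp
      have "fill_inv \<mu>0 q i c R T0 S v' \<mu>' T'"
        using fill_inv_regs[OF inv _ regs(1)] conjunct1[OF *] unfolding eqs(1,2) \<mu> by blast
      then have "fill_inv \<mu>0 q i c R T0 (insert (X, x) S) v' \<mu>' (T'(?j := 1))"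
        using c by (rule fill_inv_hit)
      then have Q: "?Q v' \<mu>' (T'(val (mem v' \<mu>' T') (Add (reg rR) (Add (reg rW) (reg rY))) :=
          val (mem v' \<mu>' T') (Const 1)))"
        unfolding at using regs(2,3) by simp
      show "wp (Store (table_at (Add (reg rR) (Add (reg rW) (reg rY)))) (Const 1))
          (2 * unit_cost) ?Q v' \<mu>' T'"
      proof (rule wp_Store_table)
        show "bounded v' \<mu>' T'" by (rule conjunct1[OF *])
      qed (simp, simp, rule Q)
    qed
    then have rest: "wp (Seq (For rJ num_m join_step)
        (Store (table_at (Add (reg rR) (Add (reg rW) (reg rY)))) (Const 1)))
        (join_time + 2 * unit_cost) ?Q (v(rY := val (mem v \<mu> T) (reg rX))) \<mu> T"
      unfolding \<mu> using v(1) by simp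
    show "wp (Seq (Store (reg_at rY) (reg rX)) (Seq (For rJ num_m join_step)
        (Store (table_at (Add (reg rR) (Add (reg rW) (reg rY)))) (Const 1))))
        (2 * unit_cost + (join_time + 2 * unit_cost)) ?Q v \<mu> T"
    proof (rule wp_Seq_backward, rule wp_Store_reg)
      show "bounded v \<mu> T" using b \<mu> by simp
    qed (simp, simp, rule rest)
  next
    assume "val (mem v \<mu> T) move_cond = 0"
    then have "\<not> (T0 (R + X) \<noteq> 0 \<and> (inc i x \<or> \<mu>0 i \<noteq> 0))" using cond by blast
    then have "fill_inv \<mu>0 q i c R T0 (insert (X, x) S) v \<mu> T" by (rule fill_inv_skip[OF inv])
    then have "wp Skip unit_cost ?Q v \<mu> T" using v by (intro wp_Skip) auto
    then show "wp Skip (2 * unit_cost + (join_time + 2 * unit_cost)) ?Q v \<mu> T" by (rule wp_mono) auto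
  qed (use b \<mu> in auto)
  then show ?thesis by (rule wp_mono) (auto simp: move_time_def)
qed

text \<open>This is the only loop of exponential length: a row has \<open>2 ^ q\<close> cells with
  \<open>q \<le> 2 * k\<close>.\<close>

definition fill_time :: nat where
  "fill_time = loop_time (4 ^ k) (loop_time n move_time)"

lemma fill_correct:
  assumes W: "weights_below q \<mu>0" and q: "q \<le> 2 * k" and i: "i < m"
    and inv: "fill_inv \<mu>0 q i c R T0 {} v \<mu> T"
  shows "wp (For rX (reg rW) (For rV num_n move_step)) fill_time
     (fill_inv \<mu>0 q i c R T0 ({..<2 ^ q} \<times> {..<n})) v \<mu> T"
proof -
  have q4: "2 ^ q \<le> (4::nat) ^ k"
    using power_increasing[OF q, of "2::nat"] by (simp add: power_mult)
  have qb: "2 ^ q \<le> (2::nat) ^ bits" by (rule power_increasing) (use q in \<open>auto simp: bits_def\<close>)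
  let ?F = "fill_inv \<mu>0 q i c R T0"
  define A where "A X = {..<X} \<times> {..<n}" for X :: nat
  define B where "B X x = A X \<union> {X} \<times> {..<x}" for X x
  have sets: "A 0 = {}" "B X 0 = A X" "B X n = A (Suc X)" "insert (X, x) (B X x) = B X (Suc x)" for X x
    by (auto simp: A_def B_def less_Suc_eq)
  note bd = fill_invD(1)
  let ?I = "\<lambda>X v \<mu> T. ?F (A X) v \<mu> T \<and> v rX = X"
  let ?J = "\<lambda>X x v \<mu> T. ?F (B X x) v \<mu> T \<and> v rX = X \<and> v rV = x"
  note upd = fill_inv_update
  have inner: "wp (For rV num_n move_step) (loop_time n move_time) (?J X n) v \<mu> T"
    if I: "?I X v \<mu> T" and X: "X < 2 ^ q" for X v \<mu> T
  proof (rule wp_For[where I = "?J X"])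
    show "?J X 0 (v(rV := 0)) \<mu> T" using I by (auto simp: sets intro: upd)
  next
    fix x v \<mu> T assume x: "x < n" and J: "?J X x v \<mu> T"
    have xb: "Suc x \<le> 2 ^ bits" by (rule small_le_bits) (use x in simp)
    show "wp move_step move_time
       (\<lambda>v \<mu> T. bounded v \<mu> T \<and> v rV = x \<and> ?J X (Suc x) (v(rV := Suc x)) \<mu> T) v \<mu> T"
    proof (rule wp_mono[OF move_step_correct[OF W qb] order_refl])
      fix v' \<mu>' T' assume *: "?F (insert (X, x) (B X x)) v' \<mu>' T' \<and> v' rX = X \<and> v' rV = x"
      then have "?F (B X (Suc x)) v' \<mu>' T'" by (simp add: sets)
      with bd[OF this] * xb
      show "bounded v' \<mu>' T' \<and> v' rV = x \<and> ?J X (Suc x) (v'(rV := Suc x)) \<mu>' T'"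
        by (simp add: upd)
    qed (use J x X i in auto)
  qed (use I bd in auto)
  have "wp (For rX (reg rW) (For rV num_n move_step)) (loop_time (2 ^ q) (loop_time n move_time))
      (?I (2 ^ q)) v \<mu> T"
  proof (rule wp_For[where I = ?I])
    show "?I 0 (v(rX := 0)) \<mu> T" using inv by (auto simp: sets intro: upd)
  next
    fix X v \<mu> T assume X: "X < 2 ^ q" and I: "?I X v \<mu> T"
    have Xb: "Suc X \<le> 2 ^ bits" using X qb by linarith
    show "wp (For rV num_n move_step) (loop_time n move_time)
       (\<lambda>v \<mu> T. bounded v \<mu> T \<and> v rX = X \<and> ?I (Suc X) (v(rX := Suc X)) \<mu> T) v \<mu> T"
    proof (rule wp_mono[OF inner[OF I X] order_refl])
      fix v \<mu> T assume *: "?J X n v \<mu> T"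
      then have "?F (A (Suc X)) v \<mu> T" by (simp add: sets)
      with bd[OF this] * Xb
      show "bounded v \<mu> T \<and> v rX = X \<and> ?I (Suc X) (v(rX := Suc X)) \<mu> T"
        by (simp add: upd)
    qed
  next
    fix X v \<mu> T assume "?I X v \<mu> T"
    then show "bounded v \<mu> T \<and> v rX = X \<and> val (mem v \<mu> T) (reg rW) = 2 ^ q"
      using bd[of \<mu>0 q i c R T0 "A X" v \<mu> T] fill_invD(3)[of \<mu>0 q i c R T0 "A X" v \<mu> T] by simp
  qed (use inv bd in auto)
  then show ?thesis
    by (rule wp_mono) (use q4 in \<open>auto simp: A_def fill_time_def intro!: loop_time_mono\<close>)
qed

text \<open>Here \<open>r\<close> is a number of rows written after the initial one;
  \<open>r \<le> i\<close> keeps the offset within \<open>bits\<close>. The clause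
  \<open>T a \<le> 1\<close> makes the cell read at the end a truth value.\<close>

definition table_inv where
  "table_inv \<mu>0 q i v \<mu> T \<longleftrightarrow> bounded v \<mu> T \<and> \<mu> = \<mu>0 \<and> v rW = 2 ^ q \<and> v rI = i \<and>
     v rC = min k (card {j. j < i \<and> \<mu>0 j \<noteq> 0}) \<and> (\<exists>r\<le>i. v rR = 2 ^ q * r) \<and>
     (\<forall>a. T a \<le> 1) \<and> (\<forall>a\<ge>v rR + 2 ^ q. T a = 0) \<and>
     (\<forall>X<2 ^ q. T (v rR + X) \<noteq> 0 \<longleftrightarrow> X \<in> reach \<mu>0 i)"

lemma table_invD:
  assumes "table_inv \<mu>0 q i v \<mu> T"
  shows "bounded v \<mu> T" "\<mu> = \<mu>0" "v rW = 2 ^ q" "v rI = i"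
    "v rC = min k (card {j. j < i \<and> \<mu>0 j \<noteq> 0})" "\<exists>r\<le>i. v rR = 2 ^ q * r"
    "\<forall>a. T a \<le> 1" "\<forall>a\<ge>v rR + 2 ^ q. T a = 0"
    "\<forall>X<2 ^ q. T (v rR + X) \<noteq> 0 \<longleftrightarrow> X \<in> reach \<mu>0 i"
  using assms unfolding table_inv_def by - (elim conjE, assumption)+

lemma reach_less:
  assumes "weights_below q \<mu>" "X \<in> reach \<mu> i"
  shows "X < 2 ^ q"
  using assms(2) by (induction i arbitrary: X) (auto split: if_splits intro!: join_less[OF assms(1)])

lemma card_marked_Suc:
  "card {j. j < Suc i \<and> \<mu> j \<noteq> (0::nat)} = card {j. j < i \<and> \<mu> j \<noteq> 0} + of_bool (\<mu> i \<noteq> 0)"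
proof (cases "\<mu> i = 0")
  case True
  then have "{j. j < Suc i \<and> \<mu> j \<noteq> 0} = {j. j < i \<and> \<mu> j \<noteq> 0}" by (auto simp: less_Suc_eq)
  with True show ?thesis by simp
next
  case False
  then have "{j. j < Suc i \<and> \<mu> j \<noteq> 0} = insert i {j. j < i \<and> \<mu> j \<noteq> 0}" by (auto simp: less_Suc_eq)
  with False show ?thesis by simp
qed

lemma row_step_correct:
  assumes W: "weights_below q \<mu>0" and q: "q \<le> 2 * k" and i: "i < m"
    and inv: "table_inv \<mu>0 q i v \<mu> T"
  shows "wp row_step (3 * unit_cost + fill_time) (\<lambda>v \<mu> T. bounded v \<mu> T \<and> v rI = i \<and>
     table_inv \<mu>0 q (Suc i) (v(rI := Suc i)) \<mu> T) v \<mu> T"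
proof -
  let ?Q = "\<lambda>v \<mu> T. bounded v \<mu> T \<and> v rI = i \<and> table_inv \<mu>0 q (Suc i) (v(rI := Suc i)) \<mu> T"
  let ?c = "card {j. j < i \<and> \<mu>0 j \<noteq> 0}" and ?R = "v rR"
  note b = table_invD(1)[OF inv] and \<mu> = table_invD(2)[OF inv] and w = table_invD(3-5)[OF inv]
  have T1: "T a \<le> 1" for a using table_invD(7)[OF inv] by blast
  have T0: "T a = 0" if "a \<ge> ?R + 2 ^ q" for a using table_invD(8)[OF inv] that by blast
  have TX: "T (?R + X) \<noteq> 0 \<longleftrightarrow> X \<in> reach \<mu>0 i" if "X < 2 ^ q" for X
    using table_invD(9)[OF inv] that by blast
  obtain r where r: "r \<le> i" "?R = 2 ^ q * r" using table_invD(6)[OF inv] by blast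
  have q4: "2 ^ q \<le> (4::nat) ^ k"
    using power_increasing[OF q, of "2::nat"] by (simp add: power_mult)
  have ib: "Suc i \<le> 2 ^ bits" by (rule small_le_bits) (use i in simp)
  \<comment> \<open>The end of the current row, which becomes the next offset, is a power of at most
    \<open>4 ^ k\<close> times a row count, the form that \<open>le_bits\<close> accepts.\<close>
  have "2 ^ q * (r + 1) \<le> 4 ^ k * (i + 1)" by (intro mult_mono) (use q4 r in auto)
  then have Rb: "?R + 2 ^ q \<le> 2 ^ bits"
    using r i by (intro le_bits[of _ i]) (auto simp: algebra_simps)
  have cond: "val (mem v \<mu> T) row_cond \<noteq> 0 \<longleftrightarrow> row \<mu>0 i"
    unfolding row_cond_def row_def using w i \<mu> by auto
  have "wp row_step (unit_cost + (fill_time + 2 * unit_cost)) ?Q v \<mu> T"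
    unfolding row_step_def
  proof (rule wp_If)
    assume "val (mem v \<mu> T) row_cond \<noteq> 0"
    then have row: "row \<mu>0 i" using cond by blast
    have "fill_inv \<mu>0 q i (min k ?c) ?R T {} v \<mu> T"
      unfolding fill_inv_def using b \<mu> w T0 by auto
    note fill = fill_correct[OF W q i this]
    show "wp (Seq (For rX (reg rW) (For rV num_n move_step)) (Store (reg_at rR) (Add (reg rR) (reg rW))))
       (fill_time + 2 * unit_cost) ?Q v \<mu> T"
    proof (rule wp_Seq[OF fill])
      fix v' \<mu>' T'
      assume F: "fill_inv \<mu>0 q i (min k ?c) ?R T ({..<2 ^ q} \<times> {..<n}) v' \<mu>' T'"
      let ?v = "v'(rR := ?R + 2 ^ q)"
      note f = fill_invD(1-6)[OF F]
      have lo: "T' a = T a" if "a < ?R + 2 ^ q" for a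
        using fill_invD(7)[OF F] that by blast
      have hi: "T' (?R + 2 ^ q + Y) = of_bool (Y \<in> reach \<mu>0 (Suc i))" for Y
      proof -
        have "T' (?R + 2 ^ q + Y) =
            of_bool (\<exists>(X, x)\<in>{..<2 ^ q} \<times> {..<n}. move \<mu>0 q i ?R T X x (?R + 2 ^ q + Y))"
          using fill_invD(8)[OF F] by simp
        also have "(\<exists>(X, x)\<in>{..<2 ^ q} \<times> {..<n}. move \<mu>0 q i ?R T X x (?R + 2 ^ q + Y)) \<longleftrightarrow>
            (\<exists>X x. X < 2 ^ q \<and> X \<in> reach \<mu>0 i \<and> x < n \<and> (inc i x \<or> \<mu>0 i \<noteq> 0) \<and> Y = join \<mu>0 x m X)"
          unfolding move_def using TX by (auto simp del: neq0_conv)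
        also have "\<dots> \<longleftrightarrow> Y \<in> reach \<mu>0 (Suc i)"
          using row reach_less[OF W] by auto
        finally show ?thesis .
      qed
      have hi': "T' a = of_bool (a - (?R + 2 ^ q) \<in> reach \<mu>0 (Suc i))" if "a \<ge> ?R + 2 ^ q" for a
        using hi[of "a - (?R + 2 ^ q)"] that by simp
      have "T' a \<le> 1" for a
        using lo[of a] hi'[of a] T1[of a] by (cases "a < ?R + 2 ^ q") auto
      moreover have "T' a = 0" if "a \<ge> ?R + 2 ^ q + 2 ^ q" for a
        using hi'[of a] that reach_less[OF W, of "a - (?R + 2 ^ q)" "Suc i"] by (auto simp del: reach.simps)
      moreover have "\<exists>r\<le>Suc i. ?R + 2 ^ q = 2 ^ q * r"
        using r by (intro exI[of _ "Suc r"]) auto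
      \<comment> \<open>At a row, either the edge is unmarked and the count stays, or the count has
        already reached \<open>k\<close> and the minimum stays.\<close>
      moreover have "min k ?c = min k (card {j. j < Suc i \<and> \<mu>0 j \<noteq> 0})"
        using row unfolding card_marked_Suc row_def by auto
      moreover have "bounded (?v(rI := Suc i)) \<mu>' T'"
        using f Rb ib by (intro bounded_reg) auto
      ultimately have "table_inv \<mu>0 q (Suc i) (?v(rI := Suc i)) \<mu>' T'"
        unfolding table_inv_def using f hi by (auto simp del: reach.simps)
      then show "wp (Store (reg_at rR) (Add (reg rR) (reg rW))) (2 * unit_cost) ?Q v' \<mu>' T'"
        using f Rb by (intro wp_Store_reg) (auto simp: bounded_reg)
    qed
  next
    assume "val (mem v \<mu> T) row_cond = 0"
    then have row: "\<not> row \<mu>0 i" using cond by blast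
    then have c: "?c < k" "\<mu>0 i \<noteq> 0" by (auto simp: row_def)
    have "Suc ?c \<le> 2 ^ bits" using c k_le_bits by linarith
    moreover have "table_inv \<mu>0 q (Suc i) (v(rC := Suc ?c, rI := Suc i)) \<mu> T"
      using inv c row ib calculation unfolding table_inv_def card_marked_Suc
      by (auto intro!: bounded_reg le_SucI)
    ultimately have "wp (Store (reg_at rC) (Add (reg rC) (Const 1))) (2 * unit_cost) ?Q v \<mu> T"
      using b w c by (intro wp_Store_reg) (auto simp: bounded_reg)
    then show "wp (Store (reg_at rC) (Add (reg rC) (Const 1))) (fill_time + 2 * unit_cost) ?Q v \<mu> T"
      by (rule wp_mono) auto
  qed (use b in auto)
  then show ?thesis by (rule wp_mono) auto
qed

definition table_time :: nat where
  "table_time = 2 * unit_cost + loop_time m (3 * unit_cost + fill_time)"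

lemma table_phase_correct:
  assumes W: "weights_below q \<mu>" and q: "q \<le> 2 * k" and b: "bounded v \<mu> (\<lambda>_. 0)"
    and v: "v rW = 2 ^ q" "v rR = 0" "v rC = 0"
  shows "wp table_phase table_time (table_inv \<mu> q m) v \<mu> (\<lambda>_. 0)"
  unfolding table_phase_def table_time_def
proof (rule wp_Seq)
  let ?Q = "\<lambda>v \<mu>' T. bounded v \<mu>' T \<and> table_inv \<mu> q 0 (v(rI := 0)) \<mu>' T"
  have b': "bounded v \<mu> ((\<lambda>_. 0)(0 := 1))" by (rule bounded_table[OF b]) simp
  moreover have "table_inv \<mu> q 0 (v(rI := 0)) \<mu> ((\<lambda>_. 0)(0 := 1))"
    unfolding table_inv_def using bounded_reg[OF b', of 0 rI] v by simp
  ultimately have Q: "?Q v \<mu> ((\<lambda>_. 0)(val (mem v \<mu> (\<lambda>_. 0)) (Const 0) :=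
      val (mem v \<mu> (\<lambda>_. 0)) (Const 1)))"
    by simp
  show "wp (Store (table_at (Const 0)) (Const 1)) (2 * unit_cost) ?Q v \<mu> (\<lambda>_. 0)"
    by (rule wp_Store_table) (simp, simp, rule b, rule Q)
next
  fix v \<mu>' T
  assume A: "bounded v \<mu>' T \<and> table_inv \<mu> q 0 (v(rI := 0)) \<mu>' T"
  show "wp (For rI num_m row_step) (loop_time m (3 * unit_cost + fill_time)) (table_inv \<mu> q m) v \<mu>' T"
  proof (rule wp_For[where I = "table_inv \<mu> q"])
    fix i v \<mu>' T assume "table_inv \<mu> q i v \<mu>' T"
    from table_invD(1,4)[OF this] show "bounded v \<mu>' T \<and> v rI = i \<and> val (mem v \<mu>' T) num_m = m"
      by simp
  qed (rule row_step_correct[OF W q] | simp add: A)+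
qed

section \<open>Correctness of the reduction\<close>

lemma matching_weights_below: "matching p \<mu> \<Longrightarrow> weights_below (2 * p) \<mu>"
  by (simp add: matching_def weights_below_def)

section \<open>Counting marked edges and rows\<close>

lemma matching_inj:
  "matching p \<mu> \<Longrightarrow> i < m \<Longrightarrow> j < m \<Longrightarrow> \<mu> i = \<mu> j \<Longrightarrow> \<mu> i \<noteq> 0 \<Longrightarrow> i = j"
  unfolding matching_def by blast

text \<open>The weight function maps the marked edges bijectively onto the powers
  \<open>2 ^ b\<close> with \<open>b < 2 * p\<close>.\<close>

lemma card_marked:
  assumes "matching p \<mu>"
  shows "card {j. j < m \<and> \<mu> j \<noteq> 0} = 2 * p"
proof -
  have "inj_on \<mu> {j. j < m \<and> \<mu> j \<noteq> 0}"
    using assms unfolding matching_def inj_on_def by blast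
  moreover have "\<mu> ` {j. j < m \<and> \<mu> j \<noteq> 0} = (\<lambda>b. 2 ^ b) ` {..<2 * p}"
  proof
    show "\<mu> ` {j. j < m \<and> \<mu> j \<noteq> 0} \<subseteq> (\<lambda>b. 2 ^ b) ` {..<2 * p}"
      using assms unfolding matching_def by blast
    show "(\<lambda>b. 2 ^ b) ` {..<2 * p} \<subseteq> \<mu> ` {j. j < m \<and> \<mu> j \<noteq> 0}"
    proof
      fix w :: nat assume "w \<in> (\<lambda>b. 2 ^ b) ` {..<2 * p}"
      then obtain b where b: "b < 2 * p" "w = 2 ^ b" by blast
      then obtain i where i: "i < m" "\<mu> i = w" using assms unfolding matching_def by blast
      then have "\<mu> i \<noteq> 0" using b by simp
      with i show "w \<in> \<mu> ` {j. j < m \<and> \<mu> j \<noteq> 0}" by blast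
    qed
  qed
  moreover have "inj_on (\<lambda>b. 2 ^ b :: nat) {..<2 * p}" by (auto intro: inj_onI)
  ultimately show ?thesis using card_image[of \<mu> "{j. j < m \<and> \<mu> j \<noteq> 0}"]
      card_image[of "\<lambda>b. 2 ^ b :: nat" "{..<2 * p}"] by simp
qed

lemma card_unmarked_marked: "card {i. i < m \<and> \<mu> i = (0::nat)} + card {i. i < m \<and> \<mu> i \<noteq> 0} = m"
proof -
  have "card {i. i < m \<and> \<mu> i = 0} + card {i. i < m \<and> \<mu> i \<noteq> 0} =
      card ({i. i < m \<and> \<mu> i = 0} \<union> {i. i < m \<and> \<mu> i \<noteq> 0})"
    by (rule card_Un_disjoint[symmetric]) auto
  also have "{i. i < m \<and> \<mu> i = 0} \<union> {i. i < m \<and> \<mu> i \<noteq> 0} = {..<m}" by auto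
  finally show ?thesis by simp
qed

text \<open>The edges without a row are the first \<open>k\<close> marked ones, or all marked ones
  if there are fewer. For \<open>k \<le> 2 * p\<close> this leaves \<open>m - k\<close> rows, the
  size allowed to the hitting set.\<close>

lemma card_rows: "card {i. i < l \<and> row \<mu> i} + min k (card {j. j < l \<and> \<mu> j \<noteq> 0}) = l"
proof (induction l)
  case 0
  then show ?case by simp
next
  case (Suc l)
  have "card {i. i < Suc l \<and> row \<mu> i} = card {i. i < l \<and> row \<mu> i} + of_bool (row \<mu> l)"
  proof (cases "row \<mu> l")
    case True
    then have "{i. i < Suc l \<and> row \<mu> i} = insert l {i. i < l \<and> row \<mu> i}"
      by (auto simp: less_Suc_eq)
    with True show ?thesis by simp
  next
    case False
    then have "{i. i < Suc l \<and> row \<mu> i} = {i. i < l \<and> row \<mu> i}" by (auto simp: less_Suc_eq)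
    with False show ?thesis by simp
  qed
  with Suc show ?case unfolding card_marked_Suc row_def by auto
qed

section \<open>Reachable sets as unions over chosen vertices\<close>

primrec collect :: "(nat \<Rightarrow> nat) \<Rightarrow> (nat \<Rightarrow> nat) \<Rightarrow> nat \<Rightarrow> nat" where
  "collect \<mu> g 0 = 0"
| "collect \<mu> g (Suc i) = (if row \<mu> i then join \<mu> (g i) m (collect \<mu> g i) else collect \<mu> g i)"

lemma collect_cong: "(\<And>i. i < l \<Longrightarrow> g i = h i) \<Longrightarrow> collect \<mu> g l = collect \<mu> h l"
  by (induction l) auto

definition choice :: "(nat \<Rightarrow> nat) \<Rightarrow> (nat \<Rightarrow> nat) \<Rightarrow> nat \<Rightarrow> bool" where
  "choice \<mu> g l \<longleftrightarrow> (\<forall>i<l. row \<mu> i \<longrightarrow> g i < n \<and> (inc i (g i) \<or> \<mu> i \<noteq> 0))"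

text \<open>A path through the table is a function \<open>g\<close> naming one vertex per row. In
  the forward direction \<open>g\<close> is redefined at \<open>l\<close> only, which
  \<open>collect\<close> does not notice before step \<open>l\<close>.\<close>

lemma reach_iff: "X \<in> reach \<mu> l \<longleftrightarrow> (\<exists>g. choice \<mu> g l \<and> X = collect \<mu> g l)"
proof (induction l arbitrary: X)
  case 0
  then show ?case by (simp add: choice_def)
next
  case (Suc l)
  show ?case
  proof
    assume X: "X \<in> reach \<mu> (Suc l)"
    show "\<exists>g. choice \<mu> g (Suc l) \<and> X = collect \<mu> g (Suc l)"
    proof (cases "row \<mu> l")
      case True
      with X obtain x Y where x: "Y \<in> reach \<mu> l" "x < n" "inc l x \<or> \<mu> l \<noteq> 0" "X = join \<mu> x m Y"
        by auto
      with Suc.IH obtain g where g: "choice \<mu> g l" "Y = collect \<mu> g l" by blast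
      have "collect \<mu> (g(l := x)) l = collect \<mu> g l" by (rule collect_cong) simp
      then have "X = collect \<mu> (g(l := x)) (Suc l)" using x g True by simp
      moreover have "choice \<mu> (g(l := x)) (Suc l)"
        using g(1) x unfolding choice_def by (simp add: less_Suc_eq)
      ultimately show ?thesis by blast
    next
      case False
      with X Suc.IH obtain g where "choice \<mu> g l" "X = collect \<mu> g l" by auto
      with False show ?thesis by (auto simp: choice_def less_Suc_eq)
    qed
  next
    assume "\<exists>g. choice \<mu> g (Suc l) \<and> X = collect \<mu> g (Suc l)"
    then obtain g where g: "choice \<mu> g (Suc l)" "X = collect \<mu> g (Suc l)" by blast
    have "choice \<mu> g l" using g(1) by (simp add: choice_def)
    then have l: "collect \<mu> g l \<in> reach \<mu> l" using Suc.IH by blast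
    show "X \<in> reach \<mu> (Suc l)"
    proof (cases "row \<mu> l")
      case True
      then have "g l < n \<and> (inc l (g l) \<or> \<mu> l \<noteq> 0)" using g(1) by (simp add: choice_def)
      with True l g(2) show ?thesis by auto
    next
      case False
      with l g(2) show ?thesis by simp
    qed
  qed
qed

lemma bit_collect:
  assumes "weights_below q \<mu>"
  shows "bit (collect \<mu> g l) b \<longleftrightarrow> (\<exists>i<l. row \<mu> i \<and> (\<exists>j<m. \<mu> j = 2 ^ b \<and> inc j (g i)))"
proof (induction l)
  case 0
  then show ?case by simp
next
  case (Suc l)
  then show ?case by (auto simp: bit_join[OF assms order_refl] less_Suc_eq)
qed

lemma mask_eq_iff:
  assumes "Y < 2 ^ q"
  shows "Y = 2 ^ q - 1 \<longleftrightarrow> (\<forall>b<q. bit (Y::nat) b)"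
proof -
  have eq: "2 ^ q - 1 = (mask q :: nat)" by (simp add: mask_eq_exp_minus_1)
  have m: "bit (mask q :: nat) b \<longleftrightarrow> b < q" for b by (simp add: bit_mask_iff)
  show ?thesis unfolding eq
  proof
    assume "Y = mask q"
    then show "\<forall>b<q. bit Y b" using m by simp
  next
    assume *: "\<forall>b<q. bit Y b"
    show "Y = mask q"
    proof (rule bit_eqI)
      fix b
      show "bit Y b \<longleftrightarrow> bit (mask q :: nat) b"
        unfolding m using * assms less_exp_iff_bits[of Y q] by (cases "b < q") auto
    qed
  qed
qed

text \<open>A code below \<open>2 ^ q\<close> is \<open>2 ^ q - 1\<close> iff its \<open>q\<close>
  lowest bits are all set, and bit \<open>b\<close> of a collected set says that some chosen vertex
  lies in an edge of weight \<open>2 ^ b\<close>.\<close>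

lemma full_reach_iff:
  assumes W: "weights_below q \<mu>"
  shows "2 ^ q - 1 \<in> reach \<mu> m \<longleftrightarrow> (\<exists>g. choice \<mu> g m \<and>
     (\<forall>b<q. \<exists>i<m. row \<mu> i \<and> (\<exists>j<m. \<mu> j = 2 ^ b \<and> inc j (g i))))"
proof -
  have "2 ^ q - 1 = collect \<mu> g m \<longleftrightarrow>
      (\<forall>b<q. \<exists>i<m. row \<mu> i \<and> (\<exists>j<m. \<mu> j = 2 ^ b \<and> inc j (g i)))" if "choice \<mu> g m" for g
  proof -
    have "collect \<mu> g m \<in> reach \<mu> m" using that reach_iff by blast
    from mask_eq_iff[OF reach_less[OF W this]] show ?thesis
      unfolding bit_collect[OF W] by (simp add: eq_commute)
  qed
  then show ?thesis unfolding reach_iff by blast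
qed

text \<open>Every row must receive a vertex, even if there are more rows than vertices to place. The
  surplus rows get vertex \<open>0\<close>, which exists by \<open>n_pos\<close>.\<close>

lemma cover_by_image:
  assumes "finite A" "finite Z" "card Z \<le> card A" "Z \<subseteq> {..<n}"
  shows "\<exists>h. (\<forall>a. h a < n) \<and> Z \<subseteq> h ` A"
proof -
  obtain f where f: "f ` Z \<subseteq> A" "inj_on f Z"
    using card_le_inj[OF assms(2,1,3)] by blast
  define h where "h a = (if a \<in> f ` Z then inv_into Z f a else 0)" for a
  have "h (f z) = z" if "z \<in> Z" for z using f that by (simp add: h_def)
  then have "Z \<subseteq> h ` A" using f by (metis image_eqI image_subset_iff subsetI)
  moreover have "h a < n" for a
    using assms(4) n_pos by (auto simp: h_def inv_into_f_f[OF f(2)])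
  ultimately show ?thesis by blast
qed

text \<open>Of the \<open>m - k\<close> rows, \<open>m - 2 * p\<close> belong to unmarked edges and
  receive \<open>u\<close>. The other \<open>2 * p - k\<close> rows accept any vertex, just enough
  for \<open>Z\<close>.\<close>

lemma full_reachI:
  assumes M: "matching p \<mu>" and k: "k \<le> 2 * p"
    and u: "\<And>i. i < m \<Longrightarrow> \<mu> i = 0 \<Longrightarrow> u i < n \<and> inc i (u i)"
    and Z: "Z \<subseteq> {..<n}" "card Z + k \<le> 2 * p"
    and cover: "\<And>j. j < m \<Longrightarrow> \<mu> j \<noteq> 0 \<Longrightarrow> \<exists>x\<in>Z \<union> u ` {i. i < m \<and> \<mu> i = 0}. inc j x"
  shows "2 ^ (2 * p) - 1 \<in> reach \<mu> m"
proof -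
  let ?U = "{i. i < m \<and> \<mu> i = 0}" and ?R = "{i. i < m \<and> \<mu> i \<noteq> 0 \<and> row \<mu> i}"
  have "card {i. i < m \<and> row \<mu> i} + k = m"
    using card_rows[of m \<mu>] card_marked[OF M] k by simp
  moreover have "card {i. i < m \<and> row \<mu> i} = card ?U + card ?R"
  proof -
    have eq: "{i. i < m \<and> row \<mu> i} = ?U \<union> ?R" by (auto simp: row_def)
    show ?thesis unfolding eq by (rule card_Un_disjoint) auto
  qed
  moreover have "card ?U + 2 * p = m" using card_unmarked_marked[of \<mu>] card_marked[OF M] by simp
  ultimately have "card Z \<le> card ?R" using Z(2) by linarith
  moreover have "finite Z" using Z(1) finite_subset by blast
  ultimately obtain h where h: "\<And>a. h a < n" "Z \<subseteq> h ` ?R"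
    using cover_by_image[of ?R Z] Z(1) by auto
  define g where "g i = (if \<mu> i = 0 then u i else h i)" for i
  have choice: "choice \<mu> g m" using u h(1) by (auto simp: choice_def g_def)
  have all: "\<exists>i<m. row \<mu> i \<and> (\<exists>j<m. \<mu> j = 2 ^ b \<and> inc j (g i))" if "b < 2 * p" for b
  proof -
    obtain j where j: "j < m" "\<mu> j = 2 ^ b" using M \<open>b < 2 * p\<close> unfolding matching_def by blast
    then obtain x where x: "x \<in> Z \<union> u ` ?U" "inc j x" using cover[of j] by auto
    have "\<exists>i<m. row \<mu> i \<and> g i = x"
    proof (cases "x \<in> u ` ?U")
      case True
      then show ?thesis by (auto simp: g_def row_def)
    next
      case False
      then obtain i where i: "i < m" "\<mu> i \<noteq> 0" "row \<mu> i" "x = h i" using x h(2) by blast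
      then have "g i = x" by (simp add: g_def)
      with i(1,3) show ?thesis by (intro exI[of _ i]) simp
    qed
    then obtain i where "i < m" "row \<mu> i" "g i = x" by blast
    then show ?thesis using j x(2) by (intro exI[of _ i]) auto
  qed
  show ?thesis
    unfolding full_reach_iff[OF matching_weights_below[OF M]]
    by (rule exI[of _ g]) (simp add: choice all)
qed

section \<open>Hitting sets and the entry of the full set\<close>

definition hits :: "nat set \<Rightarrow> bool" where
  "hits S \<longleftrightarrow> S \<subseteq> {..<n} \<and> (\<forall>i<m. \<exists>x\<in>S. inc i x)"

text \<open>The vertices chosen in the \<open>m - k\<close> rows form the hitting set; repeated
  choices only make it smaller. Unmarked edges are hit by their own row, marked ones because
  distinct weights identify the edge behind each bit.\<close>

lemma hits_of_full_reach:
  assumes M: "matching p \<mu>" and k: "k \<le> 2 * p" and full: "2 ^ (2 * p) - 1 \<in> reach \<mu> m"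
  shows "\<exists>S. hits S \<and> card S + k \<le> m"
proof -
  obtain g where g: "choice \<mu> g m"
    "\<And>b. b < 2 * p \<Longrightarrow> \<exists>i<m. row \<mu> i \<and> (\<exists>j<m. \<mu> j = 2 ^ b \<and> inc j (g i))"
    using full unfolding full_reach_iff[OF matching_weights_below[OF M]] by blast
  let ?R = "{i. i < m \<and> row \<mu> i}"
  have "\<exists>x\<in>g ` ?R. inc i x" if i: "i < m" for i
  proof (cases "\<mu> i = 0")
    case True
    then have "row \<mu> i" by (simp add: row_def)
    then have "inc i (g i)" using g(1) i True unfolding choice_def by blast
    with i \<open>row \<mu> i\<close> show ?thesis by blast
  next
    case False
    then obtain b where b: "b < 2 * p" "\<mu> i = 2 ^ b" using M i unfolding matching_def by blast
    from g(2)[OF b(1)] obtain l j where j: "l < m" "row \<mu> l" "j < m" "\<mu> j = 2 ^ b" "inc j (g l)"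
      by blast
    then have "j = i" using matching_inj[OF M, of j i] i b(2) by simp
    with j show ?thesis by blast
  qed
  moreover have "g ` ?R \<subseteq> {..<n}" using g(1) by (auto simp: choice_def)
  ultimately have "hits (g ` ?R)" by (simp add: hits_def)
  moreover have "card (g ` ?R) + k \<le> m"
    using card_image_le[of ?R g] card_rows[of m \<mu>] card_marked[OF M] k by simp
  ultimately show ?thesis by blast
qed

text \<open>Disjoint unmarked edges have distinct representatives in \<open>S\<close>, so
  \<open>m - 2 * p \<le> card S\<close>, which forces \<open>k \<le> 2 * p\<close>. Without the
  representatives, \<open>S\<close> keeps at most \<open>2 * p - k\<close> vertices; they serve as
  \<open>Z\<close> in \<open>full_reachI\<close>.\<close>

lemma full_reach_of_hits:
  assumes M: "matching p \<mu>" and "p < k"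
    and disj: "\<And>i j x. i < m \<Longrightarrow> j < i \<Longrightarrow> x < n \<Longrightarrow> \<mu> i = 0 \<Longrightarrow> \<mu> j = 0 \<Longrightarrow> \<not> (inc i x \<and> inc j x)"
    and S: "hits S" "card S + k \<le> m"
  shows "k \<le> 2 * p \<and> 2 ^ (2 * p) - 1 \<in> reach \<mu> m"
proof -
  let ?U = "{i. i < m \<and> \<mu> i = 0}"
  define u where "u i = (SOME x. x \<in> S \<and> inc i x)" for i
  have u: "u i \<in> S \<and> inc i (u i)" if "i < m" for i
    unfolding u_def by (rule someI_ex) (use S that in \<open>auto simp: hits_def\<close>)
  have Sn: "S \<subseteq> {..<n}" using S by (simp add: hits_def)
  then have fS: "finite S" using finite_subset by blast
  have "inj_on u ?U"
  proof (rule inj_onI)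
    fix i j assume ij: "i \<in> ?U" "j \<in> ?U" "u i = u j"
    show "i = j"
    proof (rule linorder_cases[of i j])
      assume "i < j"
      then show ?thesis using disj[of j i "u i"] ij u[of i] u[of j] Sn by auto
    next
      assume "j < i"
      then show ?thesis using disj[of i j "u i"] ij u[of i] u[of j] Sn by auto
    qed
  qed
  then have cU: "card (u ` ?U) = card ?U" by (rule card_image)
  have uS: "u ` ?U \<subseteq> S" using u by auto
  have m: "m = card ?U + 2 * p" using card_unmarked_marked[of \<mu>] card_marked[OF M] by simp
  have le: "card ?U \<le> card S" using card_mono[OF fS uS] cU by simp
  have k: "k \<le> 2 * p" using le m S(2) by linarith
  have "card (S - u ` ?U) = card S - card ?U" using card_Diff_subset[of "u ` ?U" S] uS cU by simp
  then have "card (S - u ` ?U) + k \<le> 2 * p" using le m S(2) by linarith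
  then have "2 ^ (2 * p) - 1 \<in> reach \<mu> m"
  proof (rule full_reachI[OF M k, rotated 2])
    show "u i < n \<and> inc i (u i)" if "i < m" for i using u[OF that] Sn by auto
    show "S - u ` ?U \<subseteq> {..<n}" using Sn by blast
    show "\<exists>x\<in>(S - u ` ?U) \<union> u ` ?U. inc j x" if "j < m" for j
      using S(1) that unfolding hits_def by blast
  qed
  with k show ?thesis by blast
qed

text \<open>One common vertex per pair gives at most \<open>k\<close> vertices that hit all marked
  edges, and for \<open>p = k\<close> exactly \<open>2 * k - k = k\<close> rows are free to take
  them.\<close>

lemma full_reach_of_pairs:
  assumes M: "matching k \<mu>" and edges: "\<And>i. i < m \<Longrightarrow> \<exists>x<n. inc i x"
  shows "2 ^ (2 * k) - 1 \<in> reach \<mu> m"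
proof -
  define u where "u i = (SOME x. x < n \<and> inc i x)" for i
  have u: "u i < n \<and> inc i (u i)" if "i < m" for i
    unfolding u_def by (rule someI_ex) (use edges[OF that] in blast)
  have "\<forall>a\<in>{..<k}. \<exists>x<n. \<exists>i<m. \<exists>j<m. \<mu> i = 2 ^ (2 * a) \<and> \<mu> j = 2 ^ (2 * a + 1) \<and> inc i x \<and> inc j x"
    using M unfolding matching_def by blast
  then obtain y where y: "\<And>a. a < k \<Longrightarrow> y a < n \<and>
      (\<exists>i<m. \<exists>j<m. \<mu> i = 2 ^ (2 * a) \<and> \<mu> j = 2 ^ (2 * a + 1) \<and> inc i (y a) \<and> inc j (y a))"
    by (metis lessThan_iff)
  show ?thesis
  proof (rule full_reachI[OF M])
    show "card (y ` {..<k}) + k \<le> 2 * k" using card_image_le[of "{..<k}" y] by simp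
    show "y ` {..<k} \<subseteq> {..<n}" using y by auto
    fix j assume j: "j < m" "\<mu> j \<noteq> 0"
    then obtain b where b: "b < 2 * k" "\<mu> j = 2 ^ b" using M unfolding matching_def by blast
    \<comment> \<open>Pair \<open>a\<close> uses the exponents \<open>2 * a\<close> and
      \<open>2 * a + 1\<close>, so an edge with exponent \<open>b\<close> lies in pair
      \<open>b div 2\<close>.\<close>
    then have a: "b div 2 < k" by simp
    then obtain i1 i2 where i: "i1 < m" "i2 < m" "\<mu> i1 = 2 ^ (2 * (b div 2))"
      "\<mu> i2 = 2 ^ (2 * (b div 2) + 1)" "inc i1 (y (b div 2))" "inc i2 (y (b div 2))"
      using y by blast
    have inj: "i = j" if "i < m" "\<mu> i = \<mu> j" for i using matching_inj[OF M that(1) j(1)] that j by simp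
    have "b = 2 * (b div 2) \<or> b = 2 * (b div 2) + 1" by arith
    then have "\<mu> i1 = \<mu> j \<or> \<mu> i2 = \<mu> j" using i(3,4) b(2) by metis
    then have "inc j (y (b div 2))" using inj i by blast
    with a show "\<exists>x\<in>y ` {..<k} \<union> u ` {i. i < m \<and> \<mu> i = 0}. inc j x" by blast
  qed (use u in auto)
qed

text \<open>If the pairing stopped early, the unmarked edges are disjoint and both implications have
  content. For \<open>p = k\<close> both sides are true.\<close>

lemma hits_iff_full_reach:
  assumes M: "matching p \<mu>"
    and disj: "p < k \<longrightarrow> unmarked_disjoint {(i, j, x). i < m \<and> j < i \<and> x < n} \<mu>"
    and edges: "\<And>i. i < m \<Longrightarrow> \<exists>x<n. inc i x"
  shows "k \<le> 2 * p \<and> 2 ^ (2 * p) - 1 \<in> reach \<mu> m \<longleftrightarrow> (\<exists>S. hits S \<and> card S + k \<le> m)"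
proof (cases "p < k")
  case True
  have "\<not> (inc i x \<and> inc j x)" if "i < m" "j < i" "x < n" "\<mu> i = 0" "\<mu> j = 0" for i j x
    using disj True that unfolding unmarked_disjoint_def by blast
  then show ?thesis using full_reach_of_hits[OF M True] hits_of_full_reach[OF M] by blast
next
  case False
  then have "p = k" using M unfolding matching_def by simp
  then show ?thesis using full_reach_of_pairs[of \<mu>] M edges hits_of_full_reach[OF M] by auto
qed

section \<open>Running time\<close>

definition total_time :: nat where
  "total_time = pair_time + (table_time + 2 * unit_cost)"

text \<open>The form constant times product of loop lengths times \<open>unit_cost\<close> is closed
  under nesting: each loop multiplies the product by its length and adds \<open>6\<close> to the
  constant, \<open>3\<close> for the loop itself and \<open>3\<close> for the overhead of its
  iterations.\<close>

lemma loop_time_le: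
  assumes "t \<le> A * P * unit_cost" "N \<le> N'" "1 \<le> N'" "1 \<le> P"
  shows "loop_time N t \<le> (A + 6) * (N' * P) * unit_cost"
proof -
  have "1 \<le> N' * P" using assms(3,4) by simp
  then have 1: "1 * (3 * unit_cost) \<le> (N' * P) * (3 * unit_cost)" by (rule mult_le_mono1)
  have 2: "N' * 1 * (3 * unit_cost) \<le> N' * P * (3 * unit_cost)"
    by (intro mult_le_mono1 mult_le_mono2 assms(4))
  have "N * (t + 3 * unit_cost) \<le> N' * (A * P * unit_cost + 3 * unit_cost)"
    by (intro mult_le_mono add_mono assms(1,2)) simp_all
  then have "loop_time N t \<le>
      (N' * P) * (3 * unit_cost) + (N' * (A * P * unit_cost) + N' * P * (3 * unit_cost))"
    unfolding loop_time_def distrib_left using 1 2 by linarith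
  also have "\<dots> = (A + 6) * (N' * P) * unit_cost" by (simp add: algebra_simps)
  finally show ?thesis .
qed

lemma total_time_le: "total_time \<le> 30804000 * 8 ^ k * (m + n) ^ 4"
proof -
  let ?s = "m + n" and ?u = unit_cost and ?q = "(4::nat) ^ k"
  have s: "1 \<le> ?s" "m \<le> ?s" "n \<le> ?s" using n_pos by auto
  have s2: "1 \<le> ?s * ?s" and q: "1 \<le> ?q" using s(1) by simp_all
  have s3: "1 \<le> ?s * (?s * ?s)" and qs: "1 \<le> ?q * (?s * ?s)" "1 \<le> ?s * (?q * (?s * ?s))"
    using s(1) s2 q by simp_all
  have up: "a * ?u \<le> a * P * ?u" if "1 \<le> P" for a P
    using mult_le_mono2[OF that, of a] by (intro mult_le_mono1) simp
  have "loop_time n (9 * ?u) \<le> (9 + 6) * (?s * 1) * ?u"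
    by (rule loop_time_le) (use s in auto)
  then have "loop_time m (loop_time n (9 * ?u)) \<le> (15 + 6) * (?s * ?s) * ?u"
    by (intro loop_time_le) (use s in auto)
  then have "loop_time m (loop_time m (loop_time n (9 * ?u))) \<le> (21 + 6) * (?s * (?s * ?s)) * ?u"
    by (intro loop_time_le) (use s s2 in auto)
  then have "pair_time \<le> 29 * (?s * (?s * ?s)) * ?u"
    unfolding pair_time_def using up[OF s3, of 2] by (simp add: algebra_simps)
  also have "\<dots> \<le> 29 * (?q * (?s * (?s * ?s))) * ?u"
    by (intro mult_le_mono1 mult_le_mono2) (use q in simp)
  finally have pair: "pair_time \<le> 29 * (?s * (?q * (?s * ?s))) * ?u" by (simp add: mult_ac)
  have "join_time \<le> (3 + 6) * (?s * 1) * ?u"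
    unfolding join_time_def by (rule loop_time_le) (use s in auto)
  then have "move_time \<le> 14 * ?s * ?u"
    unfolding move_time_def using up[OF s(1), of 5] by (simp add: algebra_simps)
  then have "loop_time n move_time \<le> (14 + 6) * (?s * ?s) * ?u"
    by (intro loop_time_le) (use s in auto)
  then have "fill_time \<le> (20 + 6) * (?q * (?s * ?s)) * ?u"
    unfolding fill_time_def by (intro loop_time_le) (use s2 in auto)
  then have "3 * ?u + fill_time \<le> 29 * (?q * (?s * ?s)) * ?u"
    using up[OF qs(1), of 3] by (simp add: algebra_simps)
  then have "loop_time m (3 * ?u + fill_time) \<le> (29 + 6) * (?s * (?q * (?s * ?s))) * ?u"
    by (intro loop_time_le) (use s qs in auto)
  then have "table_time + 2 * ?u \<le> 39 * (?s * (?q * (?s * ?s))) * ?u"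
    unfolding table_time_def using up[OF qs(2), of 4] by (simp add: algebra_simps)
  with pair have total: "total_time \<le> 68 * (?s * (?q * (?s * ?s))) * ?u"
    unfolding total_time_def by (simp add: algebra_simps)
  have "k + 1 \<le> 2 ^ k" using Suc_leI[OF less_exp, of k] by simp
  have "bits \<le> 5 * (?s * (k + 1))"
  proof -
    have "2 * k \<le> 2 * (?s * k)" "4 \<le> 4 * ?s" using s(1) by simp_all
    then show ?thesis unfolding bits_def by (simp add: algebra_simps)
  qed
  also have "\<dots> \<le> 5 * (?s * 2 ^ k)"
    using \<open>k + 1 \<le> 2 ^ k\<close> by (intro mult_le_mono2)
  finally have b: "bits \<le> 5 * (?s * 2 ^ k)" .
  have "1 \<le> bits" by (simp add: bits_def)
  \<comment> \<open>\<open>90600 = 300 * (300 + 2)\<close>, where \<open>1 \<le> bits\<close>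
    absorbs the summand \<open>2\<close> of \<open>unit_cost\<close>.\<close>
  then have "?u \<le> 90600 * bits" by (simp add: unit_cost_def)
  with b have u: "?u \<le> 453000 * (?s * 2 ^ k)" by simp
  \<comment> \<open>Here \<open>68 = 29 + 39\<close> adds the constants of the two phases, the
    second including the final store, and \<open>453000 = 5 * 90600\<close>. Their product is the
    constant of the statement.\<close>
  have "total_time \<le> 68 * (?s * (?q * (?s * ?s))) * (453000 * (?s * 2 ^ k))"
    using total mult_le_mono2[OF u, of "68 * (?s * (?q * (?s * ?s)))"] by (rule order_trans)
  also have "\<dots> = 30804000 * (?q * 2 ^ k) * ?s ^ 4" by (simp add: power4_eq_xxxx mult_ac)
  also have "?q * 2 ^ k = 8 ^ k" by (simp flip: power_mult_distrib)
  finally show ?thesis .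
qed

section \<open>Assembling the phases\<close>

lemma hitting_set_prog_correct:
  assumes edges: "\<And>i. i < m \<Longrightarrow> \<exists>x<n. inc i x"
  shows "\<exists>u M'. exec hitting_set_prog (mem (\<lambda>_. 0) (\<lambda>_. 0) (\<lambda>_. 0)) \<omega> u M' \<omega> \<and> u \<le> total_time
     \<and> M' 0 = of_bool (\<exists>S. hits S \<and> card S + k \<le> m)"
proof -
  obtain u1 v1 \<mu> T1 where e1: "exec pair_phase (mem (\<lambda>_. 0) (\<lambda>_. 0) (\<lambda>_. 0)) \<omega> u1 (mem v1 \<mu> T1) \<omega>"
    and u1: "u1 \<le> pair_time" and inv: "pair_inv {(i, j, x). i < m \<and> j < i \<and> x < n} v1 \<mu> T1"
    using pair_phase_correct unfolding wp_def by blast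
  define p where "p = v1 rP"
  from inv have T1: "T1 = (\<lambda>_. 0)" by (simp add: pair_inv_def)
  from inv have "bounded v1 \<mu> T1" unfolding pair_inv_def by blast
  with T1 have b1: "bounded v1 \<mu> (\<lambda>_. 0)" by simp
  from inv have v1: "v1 rW = 2 ^ (2 * p)" "v1 rR = 0" "v1 rC = 0"
    by (simp_all add: pair_inv_def p_def power_mult)
  from inv have M: "matching p \<mu>" unfolding pair_inv_def p_def by blast
  from inv have disj: "p < k \<longrightarrow> unmarked_disjoint {(i, j, x). i < m \<and> j < i \<and> x < n} \<mu>"
    unfolding pair_inv_def p_def by blast
  note W = matching_weights_below[OF M]
  have "2 * p \<le> 2 * k" using M by (simp add: matching_def)
  from table_phase_correct[OF W this b1 v1] obtain u2 v2 \<mu>2 T2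
    where e2: "exec table_phase (mem v1 \<mu> T1) \<omega> u2 (mem v2 \<mu>2 T2) \<omega>"
      and u2: "u2 \<le> table_time" and tab: "table_inv \<mu> (2 * p) m v2 \<mu>2 T2"
    unfolding wp_def T1 by blast
  let ?M = "mem v2 \<mu>2 T2"
  have c: "v2 rC = min k (2 * p)" using table_invD(5)[OF tab] card_marked[OF M] by simp
  have "2 ^ (2 * p) - 1 < (2::nat) ^ (2 * p)" by simp
  then have "T2 (v2 rR + (2 ^ (2 * p) - 1)) \<noteq> 0 \<longleftrightarrow> 2 ^ (2 * p) - 1 \<in> reach \<mu> m"
    using table_invD(9)[OF tab] by blast
  moreover have "T2 (v2 rR + (2 ^ (2 * p) - 1)) \<le> 1" using table_invD(7)[OF tab] by blast
  ultimately have t: "T2 (v2 rR + (2 ^ (2 * p) - 1)) = of_bool (2 ^ (2 * p) - 1 \<in> reach \<mu> m)"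
    by (cases "2 ^ (2 * p) - 1 \<in> reach \<mu> m") auto
  \<comment> \<open>The counter of skipped edges ends as \<open>min k (2 * p)\<close>, so the first
    factor of \<open>result\<close> tests \<open>k \<le> 2 * p\<close>.\<close>
  have "1 - (k - min k (2 * p)) = of_bool (k \<le> 2 * p)" by (cases "k \<le> 2 * p") auto
  then have "val ?M result = of_bool (k \<le> 2 * p) * of_bool (2 ^ (2 * p) - 1 \<in> reach \<mu> m)"
    unfolding result_def using c t table_invD(3)[OF tab] by simp
  also have "\<dots> = of_bool (k \<le> 2 * p \<and> 2 ^ (2 * p) - 1 \<in> reach \<mu> m)" by simp
  also have "\<dots> = of_bool (\<exists>S. hits S \<and> card S + k \<le> m)"
    by (rule arg_cong[OF hits_iff_full_reach[OF M disj edges]])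
  finally have res: "val ?M result = of_bool (\<exists>S. hits S \<and> card S + k \<le> m)" .
  have e3: "exec (Store (Const 0) result) ?M \<omega> (cost ?M (Const 0) + cost ?M result)
      (?M(val ?M (Const 0) := val ?M result)) \<omega>"
    by (rule exec.Store)
  have "cost ?M (Const 0) \<le> unit_cost" "cost ?M result \<le> unit_cost"
    by (rule cost_small[OF table_invD(1)[OF tab]], simp)+
  with u1 u2 have "u1 + (u2 + (cost ?M (Const 0) + cost ?M result)) \<le> total_time"
    unfolding total_time_def by linarith
  moreover have "exec hitting_set_prog (mem (\<lambda>_. 0) (\<lambda>_. 0) (\<lambda>_. 0)) \<omega>
      (u1 + (u2 + (cost ?M (Const 0) + cost ?M result))) (?M(val ?M (Const 0) := val ?M result)) \<omega>"
    unfolding hitting_set_prog_def by (intro exec.Seq[OF e1] exec.Seq[OF e2] e3)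
  moreover have "(?M(val ?M (Const 0) := val ?M result)) 0 = of_bool (\<exists>S. hits S \<and> card S + k \<le> m)"
    using res by simp
  ultimately show ?thesis by blast
qed

end

section \<open>The theorem\<close>

text \<open>As \<open>n\<close> is positive, a cell lies in the incidence matrix iff its row index
  is below \<open>m\<close>; all cells behind the matrix are \<open>0\<close> on both sides.\<close>

lemma input_eq_mem:
  assumes "vs \<noteq> []"
  shows "input vs es k = incidence.mem (length vs) (length es) k (\<lambda>i j. vs ! j \<in> es ! i)
    (\<lambda>_. 0) (\<lambda>_. 0) (\<lambda>_. 0)"
proof
  fix a
  interpret incidence "length vs" "length es" k "\<lambda>i j. vs ! j \<in> es ! i"
    by standard (use assms in simp)
  have "a - 3 < length es * length vs \<longleftrightarrow> (a - 3) div length vs < length es"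
    using assms by (simp add: div_less_iff_less_mult)
  then show "input vs es k a = mem (\<lambda>_. 0) (\<lambda>_. 0) (\<lambda>_. 0) a"
    unfolding input_def mem_def by (auto simp: Let_def)
qed

text \<open>Vertices are replaced by their positions in \<open>vs\<close>. Distinctness preserves
  the size in one direction; in the other an image is never larger. The integer bound becomes
  \<open>card S + k \<le> m\<close>, which is unsatisfiable for \<open>k > m\<close>, as it should
  be.\<close>

lemma m_minus_k_hitting_set_iff_hits:
  assumes H: "hypergraph V E" and P: "presents vs es V E"
  shows "m_minus_k_hitting_set V E k \<longleftrightarrow>
    (\<exists>S. incidence.hits (length vs) (length es) (\<lambda>i j. vs ! j \<in> es ! i) S \<and> card S + k \<le> length es)"
proof -
  have vs: "distinct vs" "set vs = V" and E: "mset es = E" using P by (auto simp: presents_def)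
  then have "vs \<noteq> []" using hypergraph.vertices_nonempty[OF H] by auto
  then interpret incidence "length vs" "length es" k "\<lambda>i j. vs ! j \<in> es ! i"
    by unfold_locales simp
  have size: "size E = length es" using E by auto
  show ?thesis
  proof
    assume "m_minus_k_hitting_set V E k"
    then obtain S where S: "S \<subseteq> V" "\<And>e. e \<in># E \<Longrightarrow> e \<inter> S \<noteq> {}" "card S + k \<le> length es"
      unfolding m_minus_k_hitting_set_def hitting_set_def size by auto
    let ?J = "{j. j < length vs \<and> vs ! j \<in> S}"
    have "inj_on ((!) vs) ?J" using vs(1) by (auto simp: inj_on_def nth_eq_iff_index_eq)
    moreover have "(!) vs ` ?J = S"
    proof
      show "S \<subseteq> (!) vs ` ?J"
      proof
        fix x assume x: "x \<in> S"
        then obtain j where "j < length vs" "vs ! j = x"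
          using S(1) vs(2) by (metis in_set_conv_nth subsetD)
        with x show "x \<in> (!) vs ` ?J" by auto
      qed
    qed auto
    ultimately have "card ?J = card S" by (metis card_image)
    moreover have "\<exists>j\<in>?J. vs ! j \<in> es ! i" if "i < length es" for i
    proof -
      have "es ! i \<in># E" using that E by auto
      then obtain x where x: "x \<in> es ! i" "x \<in> S" using S(2) by blast
      then obtain j where "j < length vs" "vs ! j = x"
        using S(1) vs(2) by (metis in_set_conv_nth subsetD)
      with x show ?thesis by auto
    qed
    then have "hits ?J" unfolding hits_def by auto
    ultimately show "\<exists>S. hits S \<and> card S + k \<le> length es" using S(3) by (intro exI[of _ ?J]) simp
  next
    assume "\<exists>S. hits S \<and> card S + k \<le> length es"
    then obtain J where J: "J \<subseteq> {..<length vs}" "\<And>i. i < length es \<Longrightarrow> \<exists>j\<in>J. vs ! j \<in> es ! i"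
      "card J + k \<le> length es"
      unfolding hits_def by blast
    let ?S = "(!) vs ` J"
    have "e \<inter> ?S \<noteq> {}" if "e \<in># E" for e
    proof -
      have "e \<in> set es" using that E by auto
      then obtain i where "i < length es" "e = es ! i" by (metis in_set_conv_nth)
      with J(2)[of i] show ?thesis by blast
    qed
    moreover have "?S \<subseteq> V" using J(1) vs(2) by auto
    ultimately have "hitting_set V E ?S" by (simp add: hitting_set_def)
    moreover have "card ?S \<le> card J"
      by (rule card_image_le) (rule finite_subset[OF J(1)], simp)
    with J(3) have "int (card ?S) \<le> int (size E) - int k" unfolding size by linarith
    ultimately show "m_minus_k_hitting_set V E k" unfolding m_minus_k_hitting_set_def by blast
  qed
qed

lemma hitting_set_prog_solves:
  assumes H: "hypergraph V E" and P: "presents vs es V E"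
  shows "\<exists>u M'. exec hitting_set_prog (input vs es k) \<omega> u M' \<omega> \<and>
    u \<le> 30804000 * 8 ^ k * (size E + card V) ^ 4 \<and> M' 0 = of_bool (m_minus_k_hitting_set V E k)"
proof -
  have vs: "distinct vs" "set vs = V" and E: "mset es = E" using P by (auto simp: presents_def)
  then have ne: "vs \<noteq> []" using hypergraph.vertices_nonempty[OF H] by auto
  then interpret incidence "length vs" "length es" k "\<lambda>i j. vs ! j \<in> es ! i"
    by unfold_locales simp
  have size: "size E = length es" "card V = length vs" using E vs distinct_card by auto
  have "\<exists>x<length vs. vs ! x \<in> es ! i" if "i < length es" for i
  proof -
    have "es ! i \<in># E" using that E by auto
    then have "es ! i \<noteq> {}" "es ! i \<subseteq> V"
      using hypergraph.edge_nonempty[OF H] hypergraph.edge_subset[OF H] by blast+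
    then show ?thesis using vs(2) by (metis all_not_in_conv in_set_conv_nth subsetD)
  qed
  from hitting_set_prog_correct[OF this, of \<omega>] total_time_le show ?thesis
    unfolding input_eq_mem[OF ne] m_minus_k_hitting_set_iff_hits[OF H P] size
    by (meson le_trans)
qed

theorem theorem7:
  shows "\<exists>(p :: prog) (C :: nat) (c :: nat) (d :: nat).
    \<forall>(V :: nat set) (E :: nat set multiset) (vs :: nat list) (es :: nat set list) (k :: nat).
      hypergraph V E \<and> presents vs es V E \<and> k > 0 \<longrightarrow>
        (AE \<omega> in coins. answers p (input vs es k) \<omega> (m_minus_k_hitting_set V E k)) \<and>
        expected_time p (input vs es k)
          \<le> ennreal (real C * 8 powr (real k + real c * sqrt (real k))
                      * real (size E + card V) ^ d)"
proof (intro exI allI impI, elim conjE)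
  fix V :: "nat set" and E :: "nat set multiset" and vs :: "nat list" and es :: "nat set list" and k :: nat
  assume "hypergraph V E" "presents vs es V E"
  note solves = hitting_set_prog_solves[OF this, of k]
  let ?p = hitting_set_prog and ?I = "input vs es k"
  let ?B = "30804000 * 8 ^ k * (size E + card V) ^ 4"
  \<comment> \<open>No coin is ever read, so correctness and the time bound hold for every stream;
    the expectation inherits the bound because \<open>coins\<close> has total mass
    \<open>1\<close>.\<close>
  have "answers ?p ?I \<omega> (m_minus_k_hitting_set V E k)" for \<omega>
    using solves[of \<omega>] unfolding answers_def by blast
  moreover have "expected_time ?p ?I \<le> of_nat ?B"
  proof -
    have "run_time ?p ?I \<omega> \<le> of_nat ?B" for \<omega>
    proof -
      obtain u M' where u: "exec ?p ?I \<omega> u M' \<omega>" "u \<le> ?B" using solves[of \<omega>] by blast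
      have "run_time ?p ?I \<omega> = of_nat u" by (rule run_time_eq[OF u(1)])
      also have "\<dots> \<le> of_nat ?B" using u(2) by (simp only: of_nat_le_iff)
      finally show ?thesis .
    qed
    then have "expected_time ?p ?I \<le> (\<integral>\<^sup>+ \<omega>. of_nat ?B \<partial>coins)"
      unfolding expected_time_def by (intro nn_integral_mono) blast
    also have "\<dots> = of_nat ?B"
    proof -
      have "prob_space coins"
        unfolding coins_def by (rule prob_space.prob_space_stream_space) (rule prob_space_measure_pmf)
      then show ?thesis by (simp add: prob_space.emeasure_space_1 del: space_coins)
    qed
    finally show ?thesis .
  qed
  \<comment> \<open>The witnesses are \<open>C = 30804000\<close>, \<open>c = 0\<close> and
    \<open>d = 4\<close>; the exponent of \<open>8\<close> is exactly \<open>k\<close>.\<close>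
  moreover have "of_nat ?B = ennreal (real 30804000 * 8 powr (real k + real 0 * sqrt (real k))
      * real (size E + card V) ^ 4)"
    unfolding ennreal_of_nat_eq_real_of_nat by (simp add: powr_realpow)
  ultimately show "(AE \<omega> in coins. answers ?p ?I \<omega> (m_minus_k_hitting_set V E k)) \<and>
      expected_time ?p ?I \<le> ennreal (real 30804000 * 8 powr (real k + real 0 * sqrt (real k))
        * real (size E + card V) ^ 4)"
    by simp
qed

end
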